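(* Let $(X,T)$ be a null dynamical system. Then the following are equivalent: (1) $P(X,T)$ is closed in $X\times X$; (2) $P(X,T)=Q(X,T)$; (3) $(X,T)$ is mean equicontinuous.
   Context: A dynamical system $(X,T)$ is a compact metric space $(X,d)$ with a continuous map $T:X\to X$. $P(X,T)$ is the set of proximal pairs: $(x,y)$ with $\inf_{n\ge1}d(T^nx,T^ny)=0$. $Q(X,T)$ is the set of regionally proximal pairs: $(x,y)$ such that for every $\epsilon>0$ there are $x',y'\in X$ with $d(x,x')<\epsilon$, $d(y,y')<\epsilon$ and a positive integer $n$ with $d(T^nx',T^ny')<\epsilon$. $(X,T)$ is mean equicontinuous if for every $\epsilon>0$ there is $\delta>0$ such that $d(x,y)<\delta$ implies $\limsup_{n\to\infty}\frac1n\sum_{i=0}^{n-1}d(T^ix,T^iy)<\epsilon$. For an increasing sequence $A=\{0\le t_1<t_2<\cdots\}\subseteq\mathbb{Z}_+$ and a finite open cover $\mathcal U$, $h^A_{top}(T,\mathcal U)=\limsup_{n\to\infty}\frac1n\log N(\bigvee_{i=1}^nT^{-t_i}\mathcal U)$, where $N(\cdot)$ is the minimal cardinality of a subcover, and $h^A_{top}(T)=\sup_{\mathcal U}h^A_{top}(T,\mathcal U)$. $(X,T)$ is null if $h^A_{top}(T)=0$ for every increasing sequence $A$. *)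

theory Defs
  imports "HOL-Analysis.Analysis" "HOL-Library.Liminf_Limsup"
begin

definition dyn_sys :: "'a::metric_space set \<Rightarrow> ('a \<Rightarrow> 'a) \<Rightarrow> bool" where
  "dyn_sys X T \<longleftrightarrow> compact X \<and> continuous_on X T \<and> T ` X \<subseteq> X"

definition proximal :: "'a::metric_space set \<Rightarrow> ('a \<Rightarrow> 'a) \<Rightarrow> ('a \<times> 'a) set" where
  "proximal X T = {(x, y). x \<in> X \<and> y \<in> X \<and>
      (INF n\<in>{1..}. dist ((T ^^ n) x) ((T ^^ n) y)) = 0}"

definition regionally_proximal :: "'a::metric_space set \<Rightarrow> ('a \<Rightarrow> 'a) \<Rightarrow> ('a \<times> 'a) set" where
  "regionally_proximal X T = {(x, y). x \<in> X \<and> y \<in> X \<and>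
      (\<forall>e>0. \<exists>x'\<in>X. \<exists>y'\<in>X. \<exists>n::nat. n \<ge> 1 \<and> dist x x' < e \<and> dist y y' < e \<and>
          dist ((T ^^ n) x') ((T ^^ n) y') < e)}"

definition mean_equicontinuous :: "'a::metric_space set \<Rightarrow> ('a \<Rightarrow> 'a) \<Rightarrow> bool" where
  "mean_equicontinuous X T \<longleftrightarrow>
     (\<forall>e>0. \<exists>\<delta>>0. \<forall>x\<in>X. \<forall>y\<in>X. dist x y < \<delta> \<longrightarrow>
        limsup (\<lambda>n::nat. ereal ((\<Sum>i<n. dist ((T ^^ i) x) ((T ^^ i) y)) / real n)) < ereal e)"

definition open_cover :: "'a::metric_space set \<Rightarrow> 'a set set \<Rightarrow> bool" where
  "open_cover X \<U> \<longleftrightarrow> finite \<U> \<and> (\<forall>U\<in>\<U>. openin (top_of_set X) U) \<and> \<Union>\<U> = X"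

definition min_subcover :: "'a set \<Rightarrow> 'a set set \<Rightarrow> nat" where
  "min_subcover X C = (LEAST k. \<exists>V\<subseteq>C. finite V \<and> card V = k \<and> \<Union>V = X)"

text \<open>The join of T^{-t_1} U, ..., T^{-t_n} U (preimages taken inside X);
  the sequence is indexed t 0 < t 1 < ... .\<close>
definition join_cover :: "'a set \<Rightarrow> ('a \<Rightarrow> 'a) \<Rightarrow> (nat \<Rightarrow> nat) \<Rightarrow> 'a set set \<Rightarrow> nat \<Rightarrow> 'a set set" where
  "join_cover X T t \<U> n =
     {{x \<in> X. \<forall>i<n. (T ^^ t i) x \<in> f i} | f. \<forall>i<n. f i \<in> \<U>}"

definition seq_entropy_cover :: "'a set \<Rightarrow> ('a \<Rightarrow> 'a) \<Rightarrow> (nat \<Rightarrow> nat) \<Rightarrow> 'a set set \<Rightarrow> ereal" where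
  "seq_entropy_cover X T t \<U> =
     limsup (\<lambda>n::nat. ereal (ln (real (min_subcover X (join_cover X T t \<U> n))) / real n))"

definition seq_entropy :: "'a::metric_space set \<Rightarrow> ('a \<Rightarrow> 'a) \<Rightarrow> (nat \<Rightarrow> nat) \<Rightarrow> ereal" where
  "seq_entropy X T t = (SUP \<U>\<in>{\<U>. open_cover X \<U>}. seq_entropy_cover X T t \<U>)"

definition null_system :: "'a::metric_space set \<Rightarrow> ('a \<Rightarrow> 'a) \<Rightarrow> bool" where
  "null_system X T \<longleftrightarrow> (\<forall>t::nat \<Rightarrow> nat. strict_mono t \<longrightarrow> seq_entropy X T t = 0)"

end

theory Submission
  imports Defs
begin

text \<open>
  Mean equicontinuity forces a regionally proximal pair to have upper mean distance zero, hence to be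
  proximal, and the regionally proximal relation is always closed. The substance is that a null system with
  closed \<open>P = P(X,T)\<close> is mean equicontinuous. Nullness excludes, for a continuous function \<open>f\<close> on
  \<open>X \<times> X\<close> and a fixed gap, families of \<open>2 ^ n\<close> points told apart by the values of \<open>f\<close> at \<open>n\<close> times,
  for all \<open>n\<close>. This is used twice.

  First, distances average to zero uniformly along the pairs in \<open>P\<close>: otherwise some pair of \<open>P\<close> off the
  diagonal returns near itself with positive density, whereas by proximality it spends arbitrarily long stretches near
  the diagonal; differences of return times hit these stretches, and this doubles a separated family again and again.

  Second, nearby points stay close modulo \<open>P\<close> for all times: otherwise there are pairs \<open>w\<^sub>k\<close>
  that converge into \<open>P\<close> and escape from \<open>P\<close> at times \<open>m\<^sub>k\<close>. Applying a minimal idempotent of the Ellis semigroup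
  makes finitely many of them jointly uniformly recurrent without leaving their classes modulo \<open>P\<close>, and a pair that has
  escaped never comes back; sums of suitable return times then realise every near/far pattern on
  \<open>w\<^sub>1, \<dots>, w\<^sub>K\<close>.
\<close>

section \<open>Iterates\<close>

lemma compact_openin_increasing_cover:
  fixes G :: "nat \<Rightarrow> 'a::topological_space set"
  assumes L: "compact L" and G: "\<And>n. openin (top_of_set L) (G n)" and cov: "\<And>x. x \<in> L \<Longrightarrow> \<exists>n. x \<in> G n"
  shows "\<exists>N. \<forall>x\<in>L. \<exists>n\<le>N. x \<in> G n"
proof -
  obtain H where H: "\<And>n. open (H n)" "\<And>n. G n = L \<inter> H n"
    using G unfolding openin_open by metis
  have "L \<subseteq> (\<Union>n\<in>UNIV. H n)" using cov H(2) by blast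
  then obtain I where I: "finite I" "L \<subseteq> (\<Union>n\<in>I. H n)" using L H(1) by (metis compactE_image)
  show ?thesis
  \<comment> \<open>Inserting \<open>0\<close> keeps \<open>Max\<close> meaningful when the finite
    subcover is empty.\<close>
  proof (rule exI[of _ "Max (insert 0 I)"], rule ballI)
    fix x assume "x \<in> L"
    then obtain n where "n \<in> I" "x \<in> H n" using I(2) by blast
    then show "\<exists>n\<le>Max (insert 0 I). x \<in> G n" using \<open>x \<in> L\<close> H(2) I(1) by (intro exI[of _ n]) auto
  qed
qed

lemma dyn_sys_iter_in:
  assumes "dyn_sys X T" "x \<in> X"
  shows "(T ^^ n) x \<in> X"
  using assms by (induction n) (auto simp: dyn_sys_def)

lemma dyn_sys_continuous_iter:
  assumes "dyn_sys X T"
  shows "continuous_on X (T ^^ n)"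
proof (induction n)
  case (Suc n)
  have "continuous_on X (T \<circ> (T ^^ n))"
    using assms Suc dyn_sys_iter_in[OF assms]
    by (intro continuous_on_compose) (auto simp: dyn_sys_def intro: continuous_on_subset)
  then show ?case by simp
qed (simp add: id_def)

lemma dyn_sys_closed: "dyn_sys X T \<Longrightarrow> closed X"
  by (simp add: dyn_sys_def compact_imp_closed)

lemma funpow_map_prod:
  fixes f :: "'a \<Rightarrow> 'a" and g :: "'b \<Rightarrow> 'b"
  shows "(map_prod f g ^^ n) (x, y) = ((f ^^ n) x, (g ^^ n) y)"
  by (induction n) auto

lemma dyn_sys_map_prod:
  assumes "dyn_sys X T"
  shows "dyn_sys (X \<times> X) (map_prod T T)"
proof -
  have T: "continuous_on X T" using assms by (simp add: dyn_sys_def)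
  have "continuous_on (X \<times> X) (\<lambda>w. T (fst w))"
    by (rule continuous_on_compose2[OF T continuous_on_fst[OF continuous_on_id]]) auto
  moreover have "continuous_on (X \<times> X) (\<lambda>w. T (snd w))"
    by (rule continuous_on_compose2[OF T continuous_on_snd[OF continuous_on_id]]) auto
  ultimately have "continuous_on (X \<times> X) (\<lambda>w. (T (fst w), T (snd w)))"
    by (rule continuous_on_Pair)
  moreover have "map_prod T T = (\<lambda>w. (T (fst w), T (snd w)))" by (auto simp: map_prod_def)
  ultimately have "continuous_on (X \<times> X) (map_prod T T)" by simp
  then show ?thesis using assms by (auto simp: dyn_sys_def compact_Times)
qed

text \<open>By compactness every \<open>f\<close> composed with an iterate is uniformly continuous,
  and finitely many moduli have a positive minimum. The observable \<open>f\<close> lets the lemma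
  serve both \<open>T\<close> itself and functions of pairs.\<close>

lemma dyn_sys_equicontinuous_upto:
  fixes f :: "'a::metric_space \<Rightarrow> 'b::metric_space"
  assumes D: "dyn_sys X T" and f: "continuous_on X f" and "e > 0"
  shows "\<exists>d>0. \<forall>x\<in>X. \<forall>y\<in>X. dist x y < d \<longrightarrow> (\<forall>i\<le>n::nat. dist (f ((T ^^ i) x)) (f ((T ^^ i) y)) < e)"
proof -
  have "\<exists>d>0. \<forall>x\<in>X. \<forall>y\<in>X. dist x y < d \<longrightarrow> dist (f ((T ^^ i) x)) (f ((T ^^ i) y)) < e" for i
  proof -
    have "continuous_on X (\<lambda>x. f ((T ^^ i) x))"
      using dyn_sys_iter_in[OF D] by (intro continuous_on_compose2[OF f dyn_sys_continuous_iter[OF D]]) auto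
    then have "uniformly_continuous_on X (\<lambda>x. f ((T ^^ i) x))"
      using D by (auto simp: dyn_sys_def intro: compact_uniformly_continuous)
    then show ?thesis using \<open>e > 0\<close> unfolding uniformly_continuous_on_def by (metis dist_commute)
  qed
  then obtain d where d: "\<And>i. d i > 0"
    "\<And>i x y. x \<in> X \<Longrightarrow> y \<in> X \<Longrightarrow> dist x y < d i \<Longrightarrow> dist (f ((T ^^ i) x)) (f ((T ^^ i) y)) < e"
    by metis
  have "Min (d ` {..n}) > 0" using d by auto
  moreover have "Min (d ` {..n}) \<le> d i" if "i \<le> n" for i using that by (intro Min_le) auto
  ultimately show ?thesis using d by (intro exI[of _ "Min (d ` {..n})"]) (meson less_le_trans)
qed

text \<open>The sets of points that are low at time \<open>n\<close> are open and cover the compact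
  space, so finitely many times suffice for all points.\<close>

lemma dyn_sys_uniform_hitting:
  fixes f :: "'a::metric_space \<Rightarrow> real"
  assumes D: "dyn_sys X T" and f: "continuous_on X f" and hit: "\<And>x. x \<in> X \<Longrightarrow> \<exists>n. f ((T ^^ n) x) < e"
  shows "\<exists>L. \<forall>x\<in>X. \<exists>n\<le>L. f ((T ^^ n) x) < e"
proof -
  have op: "openin (top_of_set X) {x \<in> X. f ((T ^^ n) x) < e}" for n
  proof -
    have "continuous_on X (\<lambda>x. f ((T ^^ n) x))"
      using dyn_sys_iter_in[OF D] by (intro continuous_on_compose2[OF f dyn_sys_continuous_iter[OF D]]) auto
    from continuous_openin_preimage_gen[OF this, of "{..<e}"] show ?thesis
      by (auto simp: vimage_def Int_def)
  qed
  from compact_openin_increasing_cover[OF _ op] show ?thesis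
    using D hit unfolding dyn_sys_def by simp
qed

section \<open>Recurrence with positive density\<close>

definition visits :: "('a \<Rightarrow> 'a) \<Rightarrow> 'a set \<Rightarrow> 'a \<Rightarrow> nat \<Rightarrow> nat" where
  "visits T U x n = card {i. i < n \<and> (T ^^ i) x \<in> U}"

text \<open>The orbit segment may start at a different point for each length. For closed
  \<open>U\<close> in a compact system this expresses, without measures, that some invariant measure
  charges \<open>U\<close>.\<close>

definition pos_density :: "'a::metric_space set \<Rightarrow> ('a \<Rightarrow> 'a) \<Rightarrow> 'a set \<Rightarrow> bool" where
  "pos_density X T U \<longleftrightarrow> (\<exists>c>0. \<forall>N. \<exists>n\<ge>N. \<exists>x\<in>X. c * real n \<le> real (visits T U x n))"

lemma pos_density_nonempty:
  assumes "pos_density X T U" "U \<subseteq> X" shows "U \<noteq> {}"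
proof
  assume "U = {}"
  from assms obtain c where c: "c > 0" "\<forall>N. \<exists>n\<ge>N. \<exists>x\<in>X. c * real n \<le> real (visits T U x n)"
    unfolding pos_density_def by auto
  then obtain n x where "n \<ge> (1::nat)" "c * real n \<le> real (visits T U x n)" by blast
  moreover have "visits T U x n = 0" using \<open>U = {}\<close> by (simp add: visits_def)
  moreover have "c * real n > 0" using c(1) \<open>n \<ge> 1\<close> by simp
  ultimately show False by simp
qed

text \<open>Pigeonhole twice: on each long orbit segment some piece receives a fixed share of the
  visits, and one of the finitely many pieces does so for arbitrarily long segments.\<close>

lemma pos_density_split:
  assumes pos: "pos_density X T U" and fin: "finite J" and cov: "U \<subseteq> (\<Union>j\<in>J. V j)"
  shows "\<exists>j\<in>J. pos_density X T (V j)"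
proof -
  from pos obtain c where c: "c > 0" "\<And>N. \<exists>n\<ge>N. \<exists>x\<in>X. c * real n \<le> real (visits T U x n)"
    unfolding pos_density_def by auto
  have le: "visits T U x n \<le> (\<Sum>j\<in>J. visits T (V j) x n)" for x n
  proof -
    have "visits T U x n \<le> card (\<Union>j\<in>J. {i. i < n \<and> (T ^^ i) x \<in> V j})"
      unfolding visits_def using cov fin by (intro card_mono) auto
    also have "\<dots> \<le> (\<Sum>j\<in>J. visits T (V j) x n)"
      unfolding visits_def using fin by (rule card_UN_le)
    finally show ?thesis .
  qed
  \<comment> \<open>The extra \<open>1\<close> makes the total of the shares strictly smaller than
    \<open>c\<close>, and keeps \<open>m\<close> positive.\<close>
  define m where "m = real (card J) + 1"
  have m: "m > 0" by (simp add: m_def)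
  have ex: "\<exists>n\<ge>N. \<exists>x\<in>X. \<exists>j\<in>J. c / m * real n \<le> real (visits T (V j) x n)" for N
  proof -
    obtain n x where nx: "n \<ge> max N 1" "x \<in> X" "c * real n \<le> real (visits T U x n)" using c(2) by blast
    have "\<exists>j\<in>J. c / m * real n \<le> real (visits T (V j) x n)"
    proof (rule ccontr)
      assume "\<not> ?thesis"
      then have "(\<Sum>j\<in>J. real (visits T (V j) x n)) \<le> (\<Sum>j\<in>J. c / m * real n)"
        by (intro sum_mono) (auto simp: not_le less_imp_le)
      also have "\<dots> = c * real n * (real (card J) / m)" by simp
      also have "\<dots> < c * real n * 1"
        using c(1) nx(1) m by (intro mult_strict_left_mono) (auto simp: m_def)
      also have "\<dots> \<le> real (visits T U x n)" using nx by simp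
      also have "\<dots> \<le> real (\<Sum>j\<in>J. visits T (V j) x n)" using le of_nat_le_iff by blast
      finally show False by simp
    qed
    then show ?thesis using nx by (meson max.boundedE)
  qed
  have "\<exists>j\<in>J. \<forall>N. \<exists>n\<ge>N. \<exists>x\<in>X. c / m * real n \<le> real (visits T (V j) x n)"
  proof (rule ccontr)
    assume "\<not> ?thesis"
    then obtain N where N: "\<And>j n x. j \<in> J \<Longrightarrow> n \<ge> N j \<Longrightarrow> x \<in> X \<Longrightarrow> \<not> c / m * real n \<le> real (visits T (V j) x n)"
      by metis
    obtain n x j where "n \<ge> Max (N ` J)" "x \<in> X" "j \<in> J" "c / m * real n \<le> real (visits T (V j) x n)"
      using ex by blast
    moreover have "N j \<le> Max (N ` J)" using fin \<open>j \<in> J\<close> by auto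
    ultimately show False using N by (meson le_trans)
  qed
  then show ?thesis unfolding pos_density_def using c(1) m by (metis divide_pos_pos)
qed

text \<open>A covering argument in the manner of the maximal ergodic inequality. Walk along the
  integers: at a point \<open>i\<close> of \<open>B\<close> jump over its sparse block of length
  \<open>l i\<close>, elsewhere move by one. Elements of \<open>A\<close> inside blocks are paid for
  by \<theta>, and positions outside \<open>B\<close> are not counted. Only the last jump can
  overshoot \<open>N\<close>.\<close>

lemma greedy_block_bound:
  fixes A B :: "nat set" and l :: "nat \<Rightarrow> nat"
  assumes l: "\<And>i. i \<in> B \<Longrightarrow> l i \<ge> 1 \<and> real (card {j. i \<le> j \<and> j < i + l i \<and> j \<in> A}) \<le> \<theta> * real (l i)"
    and \<theta>: "\<theta> \<ge> 0"
  shows "\<exists>n\<ge>N. real (card {i. i < n \<and> i \<in> A \<and> i \<in> B}) \<le> \<theta> * real n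
      \<and> (\<forall>K\<ge>1. (\<forall>i\<in>B. l i \<le> K) \<longrightarrow> n \<le> N + K)"
proof (induction N)
  case 0
  show ?case by (intro exI[of _ 0]) auto
next
  case (Suc N)
  then obtain n where n: "n \<ge> N" "real (card {i. i < n \<and> i \<in> A \<and> i \<in> B}) \<le> \<theta> * real n"
    "\<forall>K\<ge>1. (\<forall>i\<in>B. l i \<le> K) \<longrightarrow> n \<le> N + K" by blast
  show ?case
  proof (cases "n = N")
    case False
    then show ?thesis using n by (intro exI[of _ n]) force
  next
    case True
    \<comment> \<open>The walk stands exactly at \<open>N\<close> and makes its next move.\<close>
    define m where "m = (if N \<in> B then N + l N else Suc N)"
    have "{i. i < m \<and> i \<in> A \<and> i \<in> B} \<subseteq> {i. i < n \<and> i \<in> A \<and> i \<in> B} \<union> {j. N \<le> j \<and> j < m \<and> j \<in> A \<and> (N \<in> B)}"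
      using True by (cases "N \<in> B") (auto simp: m_def less_Suc_eq)
    then have "card {i. i < m \<and> i \<in> A \<and> i \<in> B} \<le> card {i. i < n \<and> i \<in> A \<and> i \<in> B} + card {j. N \<le> j \<and> j < m \<and> j \<in> A \<and> (N \<in> B)}"
      by (intro order_trans[OF card_mono card_Un_le]) auto
    then have "real (card {i. i < m \<and> i \<in> A \<and> i \<in> B}) \<le> \<theta> * real n + real (card {j. N \<le> j \<and> j < m \<and> j \<in> A \<and> (N \<in> B)})"
      using n(2) by linarith
    also have "\<dots> \<le> \<theta> * real m"
    proof (cases "N \<in> B")
      case True
      then show ?thesis using l[OF True] \<open>n = N\<close> by (simp add: m_def algebra_simps)
    next
      case False
      then show ?thesis using \<open>n = N\<close> \<theta> by (simp add: m_def mult_left_mono)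
    qed
    finally show ?thesis using l n(3) True by (intro exI[of _ m]) (force simp: m_def)
  qed
qed

text \<open>Thickness yields a sequence all of whose differences lie in \<Theta>. If \<Theta> missed
  the differences of \<open>A\<close>, the translates of \<open>A\<close> by this sequence would be
  pairwise disjoint, and more of them than density \<open>c\<close> allows.\<close>

lemma density_differences_meet_thick:
  fixes A \<Theta> :: "nat set"
  assumes c: "c > 0" and A: "\<And>n. c * real n \<le> real (card {i. i < n \<and> i \<in> A})"
    and thick: "\<And>N. \<exists>v. \<forall>j\<le>N. v + j \<in> \<Theta>"
  shows "\<exists>u t. t \<in> \<Theta> \<and> u \<in> A \<and> u + t \<in> A"
proof (rule ccontr)
  assume no: "\<not> ?thesis"
  obtain v where v: "\<And>N j. j \<le> N \<Longrightarrow> v N + j \<in> \<Theta>" using thick by metis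
  \<comment> \<open>A stretch of \<Theta> of length \<open>b j\<close> starts at
    \<open>v (b j)\<close>, so it contains the differences of \<open>b (Suc j)\<close> to all
    earlier terms.\<close>
  define b where "b = rec_nat 0 (\<lambda>_ r. v r + r)"
  have b: "b (Suc j) = v (b j) + b j" for j by (simp add: b_def)
  have mono: "i \<le> j \<Longrightarrow> b i \<le> b j" for i j by (rule lift_Suc_mono_le) (auto simp: b)
  have diff: "b j - b i \<in> \<Theta>" if "i < j" for i j
  proof -
    obtain k where k: "j = Suc k" using \<open>i < j\<close> by (cases j) auto
    have "b i \<le> b k" using mono that k by auto
    then have "b j - b i = v (b k) + (b k - b i)" by (simp add: k b)
    then show ?thesis using v[of "b k - b i" "b k"] by simp
  qed
  \<comment> \<open>With \<open>n\<close> just above \<open>b M\<close>, all shifted copies fit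
    below \<open>2 * n\<close>, while \<open>M\<close> disjoint copies of size \<open>c * n\<close>
    would exceed this.\<close>
  obtain M :: nat where M: "2 / c < real M" using reals_Archimedean2 by blast
  define n where "n = Suc (b M)"
  define C where "C j = (\<lambda>a. a + (b M - b j)) ` {i. i < n \<and> i \<in> A}" for j
  have disj: "C i \<inter> C j = {}" if "i < j" "j \<le> M" for i j
  proof (rule ccontr)
    assume "C i \<inter> C j \<noteq> {}"
    then obtain a a' where a: "a \<in> A" "a' \<in> A" "a + (b M - b i) = a' + (b M - b j)" by (auto simp: C_def)
    have "b i \<le> b j" "b j \<le> b M" using mono that by auto
    then have "a' = a + (b j - b i)" using a(3) by linarith
    then show False using no a diff[OF that(1)] by blast
  qed
  have "real M * (c * real n) \<le> (\<Sum>j<M. real (card (C j)))"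
  proof -
    have "(\<Sum>j<M. c * real n) \<le> (\<Sum>j<M. real (card (C j)))"
    proof (rule sum_mono)
      fix j
      have "card (C j) = card {i. i < n \<and> i \<in> A}" unfolding C_def by (rule card_image) (auto intro: inj_onI)
      then show "c * real n \<le> real (card (C j))" using A by simp
    qed
    then show ?thesis by simp
  qed
  also have "\<dots> = real (card (\<Union>j<M. C j))"
  proof -
    have "card (\<Union>j<M. C j) = (\<Sum>j<M. card (C j))"
    proof (rule card_UN_disjoint)
      show "\<forall>i\<in>{..<M}. \<forall>j\<in>{..<M}. i \<noteq> j \<longrightarrow> C i \<inter> C j = {}"
        using disj by (metis Int_commute lessThan_iff less_imp_le linorder_neqE_nat)
    qed (auto simp: C_def)
    then show ?thesis by simp
  qed
  also have "\<dots> \<le> real (card {..<n + b M})"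
    by (intro of_nat_mono card_mono) (auto simp: C_def intro: add_less_le_mono)
  also have "\<dots> < 2 * real n" by (simp add: n_def)
  finally have *: "real M * c * real n < 2 * real n" by (simp add: mult.assoc)
  have "real M * c > 2" using M c by (simp add: field_simps)
  then have "2 * real n \<le> real M * c * real n" by (intro mult_right_mono) auto
  with * show False by simp
qed

text \<open>Visit counts to a closed set are upper semicontinuous: if the limit misses
  \<open>U\<close> at time \<open>i\<close>, so do nearby points, and only finitely many times
  matter.\<close>

lemma visits_closed:
  assumes D: "dyn_sys X T" and U: "closed U" and z: "\<And>k. z k \<in> X" "z \<longlonglongrightarrow> y" "y \<in> X"
    and ge: "\<exists>\<^sub>F k in sequentially. c \<le> real (visits T U (z k) n)"
  shows "c \<le> real (visits T U y n)"
proof -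
  have ev: "\<forall>\<^sub>F k in sequentially. (T ^^ i) (z k) \<in> U \<longrightarrow> (T ^^ i) y \<in> U" for i
  proof (cases "(T ^^ i) y \<in> U")
    case False
    have "(\<lambda>k. (T ^^ i) (z k)) \<longlonglongrightarrow> (T ^^ i) y"
      using continuous_on_tendsto_compose[OF dyn_sys_continuous_iter[OF D] z(2,3)] z(1) by simp
    then have "\<forall>\<^sub>F k in sequentially. (T ^^ i) (z k) \<in> - U"
      using U False by (intro topological_tendstoD) auto
    then show ?thesis by eventually_elim auto
  qed simp
  have "\<forall>\<^sub>F k in sequentially. \<forall>i\<in>{..<n}. (T ^^ i) (z k) \<in> U \<longrightarrow> (T ^^ i) y \<in> U"
    by (intro eventually_ball_finite ballI ev) simp
  from frequently_eventually_frequently[OF ge this]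
   obtain k where k: "c \<le> real (visits T U (z k) n)" "\<forall>i\<in>{..<n}. (T ^^ i) (z k) \<in> U \<longrightarrow> (T ^^ i) y \<in> U"
    by (metis (mono_tags, lifting) frequently_ex)
  have "visits T U (z k) n \<le> visits T U y n"
    unfolding visits_def using k(2) by (intro card_mono) auto
  with k(1) show ?thesis by simp
qed

lemma visits_shift: "visits T U ((T ^^ i) x) l = card {j. i \<le> j \<and> j < i + l \<and> (T ^^ j) x \<in> U}"
proof -
  have "{j. i \<le> j \<and> j < i + l \<and> (T ^^ j) x \<in> U} = (\<lambda>j. j + i) ` {j. j < l \<and> (T ^^ j) ((T ^^ i) x) \<in> U}"
  proof (intro set_eqI iffI)
    fix j assume "j \<in> {j. i \<le> j \<and> j < i + l \<and> (T ^^ j) x \<in> U}"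
    then have "j - i \<in> {j. j < l \<and> (T ^^ j) ((T ^^ i) x) \<in> U}" "j = (j - i) + i"
      by (auto simp flip: funpow_add comp_apply[of "T ^^ _" "T ^^ _" x])
    then show "j \<in> (\<lambda>j. j + i) ` {j. j < l \<and> (T ^^ j) ((T ^^ i) x) \<in> U}" by blast
  qed (auto simp: funpow_add)
  then show ?thesis by (simp add: visits_def card_image inj_on_def)
qed

text \<open>If every point began a block of length at most \<open>K\<close> with density below
  \<open>c / 2\<close>, chaining such blocks would make long segments too sparse. So for each
  \<open>K\<close> some point is dense on all prefixes up to \<open>K\<close>; a limit of these
  points is dense on all prefixes.\<close>

lemma pos_density_initial:
  assumes D: "dyn_sys X T" and U: "closed U" and pos: "pos_density X T U"
  shows "\<exists>c>0. \<exists>x\<in>X. \<forall>n. c * real n \<le> real (visits T U x n)"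
proof -
  from pos obtain c where c: "c > 0" "\<And>N. \<exists>n\<ge>N. \<exists>x\<in>X. c * real n \<le> real (visits T U x n)"
    unfolding pos_density_def by auto
  have "\<exists>z\<in>X. \<forall>l\<le>K. c / 2 * real l \<le> real (visits T U z l)" for K
  proof (rule ccontr)
    assume no: "\<not> ?thesis"
    \<comment> \<open>Taking \<open>N\<close> above \<open>K\<close> makes the overshoot of the
      block walk harmless: it ends before \<open>2 * N\<close>.\<close>
    obtain N x where N: "N \<ge> Suc K" "x \<in> X" "c * real N \<le> real (visits T U x N)" using c(2) by blast
    have "\<exists>l. l \<le> K \<and> real (visits T U ((T ^^ i) x) l) < c / 2 * real l" for i
      using no dyn_sys_iter_in[OF D N(2), of i] by force
    then obtain l where l: "\<And>i. l i \<le> K" "\<And>i. real (visits T U ((T ^^ i) x) (l i)) < c / 2 * real (l i)"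
      by metis
    have l1: "l i \<ge> 1" for i using l(2)[of i] by (cases "l i") auto
    have "K \<ge> 1" using l(1)[of 0] l1[of 0] by simp
    obtain n where n: "n \<ge> N" "real (card {i. i < n \<and> i \<in> {i. (T ^^ i) x \<in> U} \<and> i \<in> UNIV}) \<le> c / 2 * real n" "n \<le> N + K"
      using greedy_block_bound[of UNIV l "{i. (T ^^ i) x \<in> U}" "c / 2" N] l l1 \<open>K \<ge> 1\<close> c(1)
      by (auto simp: visits_shift less_imp_le)
    have "c * real N \<le> real (visits T U x n)"
    proof -
      have "visits T U x N \<le> visits T U x n" unfolding visits_def using n(1) by (intro card_mono) auto
      then show ?thesis using N(3) by simp
    qed
    also have "\<dots> \<le> c / 2 * real n" using n(2) by (simp add: visits_def)
    also have "\<dots> \<le> c / 2 * real (N + K)" using n(3) c(1) by (intro mult_left_mono) auto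
    also have "\<dots> < c / 2 * (2 * real N)" using N(1) c(1) by (intro mult_strict_left_mono) auto
    finally show False by simp
  qed
  then obtain z where z: "\<And>K. z K \<in> X" "\<And>K l. l \<le> K \<Longrightarrow> c / 2 * real l \<le> real (visits T U (z K) l)" by metis
  obtain y r where y: "y \<in> X" "strict_mono r" "(z \<circ> r) \<longlonglongrightarrow> y"
    using D z(1) unfolding dyn_sys_def by (metis compact_def)
  have "c / 2 * real l \<le> real (visits T U y l)" for l
  proof (rule visits_closed[OF D U _ y(3,1)])
    have "\<forall>\<^sub>F k in sequentially. k \<ge> l" by (rule eventually_ge_at_top)
    then have "\<forall>\<^sub>F k in sequentially. c / 2 * real l \<le> real (visits T U ((z \<circ> r) k) l)"
    proof eventually_elim
      case (elim k)
      then have "l \<le> r k" using seq_suble[OF y(2), of k] by simp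
      then show ?case using z(2) by simp
    qed
    then show "\<exists>\<^sub>F k in sequentially. c / 2 * real l \<le> real (visits T U ((z \<circ> r) k) l)"
      by (rule eventually_frequently[rotated]) simp
  qed (use z in auto)
  then show ?thesis using c(1) y(1) by (intro exI[of _ "c / 2"]) auto
qed

text \<open>Follow a point that is dense on all prefixes. Its visits to \<open>U\<close> at which a
  sparse block starts fill at most half of the density, so the remaining visits, which lie in
  \<open>V\<close>, have positive density too.\<close>

lemma pos_density_returning:
  assumes D: "dyn_sys X T" and U: "closed U" "U \<subseteq> X" and pos: "pos_density X T U"
  shows "\<exists>V c. closed V \<and> V \<subseteq> U \<and> pos_density X T V \<and> c > 0 \<and> (\<forall>z\<in>V. \<forall>n. c * real n \<le> real (visits T U z n))"
proof -
  obtain c x where c: "c > 0" and x: "x \<in> X" "\<And>n. c * real n \<le> real (visits T U x n)"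
    using pos_density_initial[OF D U(1) pos] by blast
  define V where "V = {z \<in> U. \<forall>n. c / 2 * real n \<le> real (visits T U z n)}"
  have "closed V"
    unfolding closed_sequential_limits
  proof (intro allI impI, elim conjE)
    fix z y assume zV: "\<forall>n. z n \<in> V" and lim: "z \<longlonglongrightarrow> y"
    have "y \<in> U" using closed_sequentially[OF U(1) _ lim] zV by (auto simp: V_def)
    moreover have "c / 2 * real n \<le> real (visits T U y n)" for n
      using zV lim \<open>y \<in> U\<close> U(2)
      by (intro visits_closed[OF D U(1), of z]) (auto simp: V_def)
    ultimately show "y \<in> V" by (simp add: V_def)
  qed
  moreover have "pos_density X T V"
    unfolding pos_density_def
  proof (intro exI[of _ "c / 2"] conjI allI)
    fix N
    \<comment> \<open>A visit to \<open>U\<close> at a time outside \<open>B\<close> is by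
      definition a visit to \<open>V\<close>.\<close>
    define B where "B = {i. \<exists>l. real (visits T U ((T ^^ i) x) l) < c / 2 * real l}"
    have "\<forall>i\<in>B. \<exists>l. real (visits T U ((T ^^ i) x) l) < c / 2 * real l" by (simp add: B_def)
    then obtain l where l: "\<And>i. i \<in> B \<Longrightarrow> real (visits T U ((T ^^ i) x) (l i)) < c / 2 * real (l i)"
      by metis
    have l1: "l i \<ge> 1" if "i \<in> B" for i using l[OF that] by (cases "l i") auto
    obtain n where n: "n \<ge> N" "real (card {i. i < n \<and> i \<in> {i. (T ^^ i) x \<in> U} \<and> i \<in> B}) \<le> c / 2 * real n"
      using greedy_block_bound[of B l "{i. (T ^^ i) x \<in> U}" "c / 2" N] l l1 c(1)
      by (auto simp: visits_shift less_imp_le)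
    have "{i. i < n \<and> (T ^^ i) x \<in> U} \<subseteq> {i. i < n \<and> (T ^^ i) x \<in> V} \<union> {i. i < n \<and> i \<in> {i. (T ^^ i) x \<in> U} \<and> i \<in> B}"
      by (auto simp: V_def B_def not_less)
    then have "visits T U x n \<le> visits T V x n + card {i. i < n \<and> i \<in> {i. (T ^^ i) x \<in> U} \<and> i \<in> B}"
      unfolding visits_def by (intro order_trans[OF card_mono card_Un_le]) auto
    then have "c / 2 * real n \<le> real (visits T V x n)" using n(2) x(2)[of n] by linarith
    then show "\<exists>n\<ge>N. \<exists>x\<in>X. c / 2 * real n \<le> real (visits T V x n)" using n(1) x(1) by blast
  qed (use c in simp)
  ultimately show ?thesis using c by (intro exI[of _ V] exI[of _ "c / 2"]) (auto simp: V_def)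
qed

text \<open>Cutting the returning set by finitely many small balls keeps one piece of positive
  density, and the return property is inherited by subsets.\<close>

lemma pos_density_small_returning:
  assumes D: "dyn_sys X T" and U: "closed U" "U \<subseteq> X" and pos: "pos_density X T U" and "e > 0"
  shows "\<exists>V c. closed V \<and> V \<subseteq> U \<and> pos_density X T V \<and> (\<forall>x\<in>V. \<forall>y\<in>V. dist x y \<le> e)
     \<and> c > 0 \<and> (\<forall>z\<in>V. \<forall>n. c * real n \<le> real (visits T U z n))"
proof -
  obtain V c where V: "closed V" "V \<subseteq> U" "pos_density X T V" "c > 0" "\<forall>z\<in>V. \<forall>n. c * real n \<le> real (visits T U z n)"
    using pos_density_returning[OF D U pos] by blast
  have "compact X" using D by (simp add: dyn_sys_def)
  then obtain F where F: "finite F" "X \<subseteq> (\<Union>x\<in>F. ball x (e / 2))"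
    using \<open>e > 0\<close> unfolding compact_eq_totally_bounded by (meson half_gt_zero)
  have "V \<subseteq> (\<Union>x\<in>F. V \<inter> cball x (e / 2))"
  proof
    fix v assume "v \<in> V"
    then obtain x where "x \<in> F" "v \<in> ball x (e / 2)" using F(2) V(2) U(2) by blast
    then show "v \<in> (\<Union>x\<in>F. V \<inter> cball x (e / 2))" using \<open>v \<in> V\<close> by (auto intro!: bexI[of _ x])
  qed
  then obtain x where "x \<in> F" "pos_density X T (V \<inter> cball x (e / 2))"
    using pos_density_split[OF V(3) F(1)] by blast
  moreover have "dist a b \<le> e" if "a \<in> cball x (e / 2)" "b \<in> cball x (e / 2)" for a b
    using that dist_triangle2[of a b x] by (simp add: dist_commute)
  ultimately show ?thesis using V
    by (intro exI[of _ "V \<inter> cball x (e / 2)"] exI[of _ c]) (auto intro: closed_Int)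
qed

text \<open>Stands in for the almost sure positive-density recurrence of a typical point of an invariant
  measure charging \<open>U\<close>.\<close>
lemma density_recurrent_point:
  assumes D: "dyn_sys X T" and U: "closed U" "U \<subseteq> X" and pos: "pos_density X T U"
  shows "\<exists>y\<in>U. \<forall>e>0. \<exists>c>0. \<forall>n. c * real n \<le> real (card {i. i < n \<and> dist ((T ^^ i) y) y < e})"
proof -
  define P where "P V \<longleftrightarrow> closed V \<and> V \<subseteq> U \<and> pos_density X T V" for V
  \<comment> \<open>A nested sequence of closed sets with shrinking diameters is built so that
    points of each set return to the preceding one with positive density; \<open>y\<close> is the
    common point.\<close>
  define R where "R k V W \<longleftrightarrow> W \<subseteq> V \<and> (\<forall>x\<in>W. \<forall>y\<in>W. dist x y \<le> 1 / real (Suc k))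
     \<and> (\<exists>c>0. \<forall>z\<in>W. \<forall>n. c * real n \<le> real (visits T V z n))" for k :: nat and V W
  have "\<exists>V. \<forall>k. P (V k) \<and> R k (V k) (V (Suc k))"
  proof (rule dependent_nat_choice)
    show "\<exists>V. P V" using U pos by (auto simp: P_def)
    fix V and k :: nat assume "P V"
    then have "closed V" "V \<subseteq> X" "pos_density X T V" "V \<subseteq> U" using U(2) by (auto simp: P_def)
    then obtain W c where W: "closed W" "W \<subseteq> V" "pos_density X T W" "\<forall>x\<in>W. \<forall>y\<in>W. dist x y \<le> 1 / real (Suc k)"
       "c > 0" "\<forall>z\<in>W. \<forall>n. c * real n \<le> real (visits T V z n)"
      using pos_density_small_returning[OF D, of V "1 / real (Suc k)"] by auto
    then have "P W" "R k V W" using \<open>V \<subseteq> U\<close> unfolding P_def R_def by blast+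
    then show "\<exists>W. P W \<and> R k V W" by blast
  qed
  then obtain V where V: "\<And>k. P (V k)" "\<And>k. R k (V k) (V (Suc k))" by blast
  have sub: "V n \<subseteq> V m" if "m \<le> n" for m n
    by (rule lift_Suc_antimono_le[OF _ that]) (use V(2) in \<open>auto simp: R_def\<close>)
  have VX: "V n \<subseteq> X" for n using V(1)[of n] U(2) by (auto simp: P_def)
  have "\<exists>z. z \<in> V n" for n using pos_density_nonempty[OF _ VX] V(1)[of n] unfolding P_def by blast
  then obtain z where z: "\<And>n. z n \<in> V n" by metis
  then obtain y r where r: "strict_mono r" "(z \<circ> r) \<longlonglongrightarrow> y"
    using D VX unfolding dyn_sys_def by (metis compact_def subsetD)
  have y: "y \<in> V k" for k
  proof (rule Lim_in_closed_set[OF _ _ _ r(2)])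
    show "closed (V k)" using V(1)[of k] by (simp add: P_def)
    have "\<forall>\<^sub>F n in sequentially. n \<ge> k" by (rule eventually_ge_at_top)
    then show "\<forall>\<^sub>F n in sequentially. (z \<circ> r) n \<in> V k"
    proof eventually_elim
      case (elim n)
      then have "k \<le> r n" using seq_suble[OF r(1), of n] by simp
      then show ?case using z[of "r n"] sub by auto
    qed
  qed simp
  have "\<exists>c>0. \<forall>n. c * real n \<le> real (card {i. i < n \<and> dist ((T ^^ i) y) y < e})" if "e > 0" for e
  proof -
    obtain k where k: "1 / real (Suc k) < e" using \<open>e > 0\<close> by (metis inverse_eq_divide reals_Archimedean)
    \<comment> \<open>\<open>V (Suc k)\<close> has diameter below \<open>e\<close> and contains
      \<open>y\<close>, so returns to it are returns close to \<open>y\<close>; membership in the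
      next set supplies their density.\<close>
    obtain c where c: "c > 0" "\<forall>z\<in>V (Suc (Suc k)). \<forall>n. c * real n \<le> real (visits T (V (Suc k)) z n)"
      using V(2)[of "Suc k"] by (auto simp: R_def)
    have "visits T (V (Suc k)) y n \<le> card {i. i < n \<and> dist ((T ^^ i) y) y < e}" for n
      unfolding visits_def
    proof (intro card_mono)
      show "{i. i < n \<and> (T ^^ i) y \<in> V (Suc k)} \<subseteq> {i. i < n \<and> dist ((T ^^ i) y) y < e}"
        using V(2)[of k] y k unfolding R_def by force
    qed simp
    then show ?thesis using c y[of "Suc (Suc k)"] by (meson of_nat_mono order_trans)
  qed
  moreover have "y \<in> U" using y[of 0] V(1)[of 0] by (auto simp: P_def)
  ultimately show ?thesis by blast
qed

section \<open>Separated families\<close>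

text \<open>The number of points is exponential in the number of sampling times, the growth that
  zero sequence entropy excludes. The bound on \<open>card A\<close> is an inequality because chosen
  times may coincide.\<close>

definition exp_separated :: "'a set \<Rightarrow> ('a \<Rightarrow> 'a) \<Rightarrow> ('a \<Rightarrow> real) \<Rightarrow> real \<Rightarrow> nat \<Rightarrow> bool" where
  "exp_separated X T f e n \<longleftrightarrow> (\<exists>E A. E \<subseteq> X \<and> finite E \<and> card E = 2 ^ n \<and> finite A \<and> card A \<le> n \<and>
     (\<forall>x\<in>E. \<forall>y\<in>E. x \<noteq> y \<longrightarrow> (\<exists>t\<in>A. e \<le> \<bar>f ((T ^^ t) x) - f ((T ^^ t) y)\<bar>)))"

lemma exp_separatedI:
  assumes x: "\<And>k. k \<in> K \<Longrightarrow> x k \<in> X" and K: "finite K" "card K = 2 ^ n" and A: "finite A" "card A \<le> n" and "e > 0"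
    and sep: "\<And>k k'. k \<in> K \<Longrightarrow> k' \<in> K \<Longrightarrow> k \<noteq> k' \<Longrightarrow> \<exists>t\<in>A. e \<le> \<bar>f ((T ^^ t) (x k)) - f ((T ^^ t) (x k'))\<bar>"
  shows "exp_separated X T f e n"
proof -
  have "inj_on x K"
  proof (rule inj_onI)
    fix k k' assume k: "k \<in> K" "k' \<in> K" "x k = x k'"
    show "k = k'"
    proof (rule ccontr)
      assume "k \<noteq> k'"
      from sep[OF k(1,2) this] k(3) \<open>e > 0\<close> show False by auto
    qed
  qed
  then have "card (x ` K) = 2 ^ n" using K by (simp add: card_image)
  moreover have "\<exists>t\<in>A. e \<le> \<bar>f ((T ^^ t) a) - f ((T ^^ t) b)\<bar>" if "a \<in> x ` K" "b \<in> x ` K" "a \<noteq> b" for a b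
    using that sep by blast
  ultimately show ?thesis unfolding exp_separated_def using x K(1) A
    by (intro exI[of _ "x ` K"] exI[of _ A]) auto
qed

text \<open>Each step glues a translate \<open>u + K\<close> to the set \<open>K\<close> of times along the orbit of \<open>y\<close>: at the new
  sampling time \<open>t\<close> the old points are in a long stretch where \<open>f\<close> is small, while \<open>u\<close> and \<open>u + t\<close> are both
  return times, so that the new points repeat the pattern of the old ones and have \<open>f\<close> large at time \<open>t\<close>.\<close>
lemma density_recurrent_exp_separated:
  fixes f :: "'a::metric_space \<Rightarrow> real"
  assumes D: "dyn_sys X T" and f: "continuous_on X f" and y: "y \<in> X" "2 * e < f y" and e: "e > 0"
    and rec: "\<And>d. d > 0 \<Longrightarrow> \<exists>c>0. \<forall>n. c * real n \<le> real (card {i. i < n \<and> dist ((T ^^ i) y) y < d})"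
    and thick: "\<And>N. \<exists>v. \<forall>j\<le>N. f ((T ^^ (v + j)) y) < e"
  shows "exp_separated X T f e n"
proof -
  define a where "a i = f ((T ^^ i) y)" for i
  \<comment> \<open>The points are orbit points of \<open>y\<close>, indexed by times in
    \<open>K\<close>. The slack \<gamma> absorbs the error of returning only approximately and is
    halved at each doubling; starting above \<open>2 * e\<close> keeps a gap \<open>e\<close> to
    values below \<open>e\<close>.\<close>
  define Q where "Q n K A \<gamma> \<longleftrightarrow> finite K \<and> card K = 2 ^ n \<and> finite A \<and> card A \<le> n \<and> \<gamma> > 0 \<and> (\<forall>k\<in>K. 2 * e + \<gamma> \<le> a k)
    \<and> (\<forall>k\<in>K. \<forall>k'\<in>K. k \<noteq> k' \<longrightarrow> (\<exists>t\<in>A. e + \<gamma> \<le> \<bar>a (k + t) - a (k' + t)\<bar>))"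
    for n :: nat and K A :: "nat set" and \<gamma>
  have "\<exists>K A \<gamma>. Q n K A \<gamma>"
  proof (induction n)
    case 0
    show ?case using y(2) by (intro exI[of _ "{0}"] exI[of _ "{}"] exI[of _ "f y - 2 * e"]) (auto simp: Q_def a_def)
  next
    case (Suc n)
    then obtain K A \<gamma> where KA: "Q n K A \<gamma>" by blast
    then have K: "finite K" "card K = 2 ^ n" and A: "finite A" "card A \<le> n" and \<gamma>: "\<gamma> > 0"
      and far: "\<And>k. k \<in> K \<Longrightarrow> 2 * e + \<gamma> \<le> a k"
      and sep: "\<And>k k'. k \<in> K \<Longrightarrow> k' \<in> K \<Longrightarrow> k \<noteq> k' \<Longrightarrow> \<exists>t\<in>A. e + \<gamma> \<le> \<bar>a (k + t) - a (k' + t)\<bar>"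
      by (simp_all add: Q_def)
    define M where "M = Max (insert 0 K) + Max (insert 0 A)"
    have KM: "k \<le> Max (insert 0 K)" if "k \<in> K" for k using that K(1) by simp
    have AM: "t \<le> Max (insert 0 A)" if "t \<in> A" for t using that A(1) by simp
    obtain d where d: "d > 0" "\<And>x z i. x \<in> X \<Longrightarrow> z \<in> X \<Longrightarrow> dist x z < d \<Longrightarrow> i \<le> M \<Longrightarrow> dist (f ((T ^^ i) x)) (f ((T ^^ i) z)) < \<gamma> / 4"
      using dyn_sys_equicontinuous_upto[OF D f, of "\<gamma> / 4" M] \<gamma> by auto
    define R where "R = {i. dist ((T ^^ i) y) y < d}"
    have R: "\<bar>a (u + i) - a i\<bar> < \<gamma> / 4" if "u \<in> R" "i \<le> M" for u i
    proof -
      have "dist (f ((T ^^ i) ((T ^^ u) y))) (f ((T ^^ i) y)) < \<gamma> / 4"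
        using that by (intro d(2)) (auto simp: R_def y dyn_sys_iter_in[OF D])
      moreover have "(T ^^ i) ((T ^^ u) y) = (T ^^ (u + i)) y" by (simp add: funpow_add add.commute[of u])
      ultimately show ?thesis by (simp add: a_def dist_real_def)
    qed
    \<comment> \<open>The candidates for the new sampling time. This set is thick because a low
      stretch longer by \<open>M\<close> accommodates all the shifts \<open>k\<close>.\<close>
    define \<Theta> where "\<Theta> = {t. \<forall>k\<in>K. a (k + t) < e}"
    have "\<exists>v. \<forall>j\<le>N. v + j \<in> \<Theta>" for N
    proof -
      obtain v where v: "\<And>j. j \<le> N + M \<Longrightarrow> a (v + j) < e" using thick[of "N + M"] unfolding a_def by blast
      have "v + j \<in> \<Theta>" if "j \<le> N" for j unfolding \<Theta>_def
      proof (intro CollectI ballI)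
        fix k assume "k \<in> K"
        then have "a (v + (j + k)) < e" using KM[of k] that by (intro v) (simp add: M_def)
        then show "a (k + (v + j)) < e" by (simp add: ac_simps)
      qed
      then show ?thesis by blast
    qed
    moreover obtain c where "c > 0" "\<And>n. c * real n \<le> real (card {i. i < n \<and> i \<in> R})"
      using rec[OF d(1)] by (auto simp: R_def)
    ultimately obtain u t where ut: "t \<in> \<Theta>" "u \<in> R" "u + t \<in> R"
      using density_differences_meet_thick[of c R \<Theta>] by metis
    define K' where "K' = (\<lambda>k. u + k) ` K"
    have near: "a (k + t) < e" if "k \<in> K" for k using ut(1) that by (simp add: \<Theta>_def)
    have far': "2 * e + \<gamma> / 2 \<le> a (u + k)" if "k \<in> K" for k
      using R[OF ut(2), of k] far[OF that] KM[OF that] by (simp add: M_def abs_if split: if_splits)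
    have far'': "2 * e + \<gamma> / 2 \<le> a (u + k + t)" if "k \<in> K" for k
    proof -
      have "\<bar>a (u + t + k) - a k\<bar> < \<gamma> / 4" using KM[OF that] by (intro R[OF ut(3)]) (simp add: M_def)
      then show ?thesis using far[OF that] by (simp add: ac_simps abs_if split: if_splits)
    qed
    have cross: "e + \<gamma> / 2 \<le> \<bar>a (k + t) - a (u + k' + t)\<bar>" if "k \<in> K" "k' \<in> K" for k k'
      using near[OF that(1)] far''[OF that(2)] by linarith
    have sep': "\<exists>t\<in>A. e + \<gamma> / 2 \<le> \<bar>a (u + k + t) - a (u + k' + t)\<bar>" if k: "k \<in> K" "k' \<in> K" "k \<noteq> k'" for k k'
    proof -
      obtain t where t: "t \<in> A" "e + \<gamma> \<le> \<bar>a (k + t) - a (k' + t)\<bar>" using sep[OF k] by blast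
      have "\<bar>a (u + (k + t)) - a (k + t)\<bar> < \<gamma> / 4" "\<bar>a (u + (k' + t)) - a (k' + t)\<bar> < \<gamma> / 4"
        using KM[OF k(1)] KM[OF k(2)] AM[OF t(1)] by (intro R[OF ut(2)]; simp add: M_def)+
      then have "e + \<gamma> / 2 \<le> \<bar>a (u + (k + t)) - a (u + (k' + t))\<bar>" using t(2) by linarith
      then show ?thesis using t(1) by (auto simp: add.assoc)
    qed
    \<comment> \<open>A common element would be separated from itself at time
      \<open>t\<close>.\<close>
    have disj: "K \<inter> K' = {}"
      using cross e \<gamma> unfolding K'_def by fastforce
    have "card K' = 2 ^ n" using K by (simp add: K'_def card_image)
    then have "card (K \<union> K') = 2 ^ Suc n" using K disj by (subst card_Un_disjoint) (auto simp: K'_def)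
    moreover have "card (insert t A) \<le> Suc n" using A by (simp add: card_insert_if)
    moreover have "2 * e + \<gamma> / 2 \<le> a k" if "k \<in> K \<union> K'" for k
      using that far far' \<gamma> by (auto simp: K'_def) (smt (verit) field_sum_of_halves)
    moreover have "\<exists>t\<in>insert t A. e + \<gamma> / 2 \<le> \<bar>a (k + t) - a (k' + t)\<bar>" if k: "k \<in> K \<union> K'" "k' \<in> K \<union> K'" "k \<noteq> k'" for k k'
    proof -
      consider "k \<in> K" "k' \<in> K" | "k \<in> K" "k' \<in> K'" | "k \<in> K'" "k' \<in> K" | "k \<in> K'" "k' \<in> K'" using k by blast
      then show ?thesis
      proof cases
        case 1
        then obtain s where "s \<in> A" "e + \<gamma> \<le> \<bar>a (k + s) - a (k' + s)\<bar>" using sep k(3) by blast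
        then show ?thesis using \<gamma> by (intro bexI[of _ s]) auto
      next
        case 2 then show ?thesis using cross by (auto simp: K'_def)
      next
        case 3 then show ?thesis using cross by (auto simp: K'_def abs_minus_commute)
      next
        case 4 then show ?thesis using sep' k(3) by (auto simp: K'_def)
      qed
    qed
    ultimately show ?case using K A \<gamma>
      by (intro exI[of _ "K \<union> K'"] exI[of _ "insert t A"] exI[of _ "\<gamma> / 2"]) (simp add: Q_def K'_def)
  qed
  then obtain K A \<gamma> where "Q n K A \<gamma>" by blast
  then have K: "finite K" "card K = 2 ^ n" "finite A" "card A \<le> n" and \<gamma>: "\<gamma> > 0"
    and sep: "\<And>k k'. k \<in> K \<Longrightarrow> k' \<in> K \<Longrightarrow> k \<noteq> k' \<Longrightarrow> \<exists>t\<in>A. e + \<gamma> \<le> \<bar>a (k + t) - a (k' + t)\<bar>"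
    by (simp_all add: Q_def)
  show ?thesis
  proof (rule exp_separatedI[where x = "\<lambda>k. (T ^^ k) y", OF _ K e])
    fix k k' assume "k \<in> K" "k' \<in> K" "k \<noteq> k'"
    then obtain t where "t \<in> A" "e + \<gamma> \<le> \<bar>a (k + t) - a (k' + t)\<bar>" using sep by blast
    then show "\<exists>t\<in>A. e \<le> \<bar>f ((T ^^ t) ((T ^^ k) y)) - f ((T ^^ t) ((T ^^ k') y))\<bar>"
      using \<gamma> by (intro bexI[of _ t]) (auto simp: a_def add.commute[of _ t] funpow_add)
  qed (use D y in \<open>simp add: dyn_sys_iter_in\<close>)
qed

text \<open>Here the points are added one at a time and the sampling times double: the time \<open>r\<close> is a common return
  time of the old points during which the new point stays far.\<close>
lemma escaping_recurrent_exp_separated: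
  fixes f :: "'a::metric_space \<Rightarrow> real" and m :: "nat \<Rightarrow> nat"
  assumes D: "dyn_sys X T" and f: "continuous_on X f" and W: "\<And>k. W k \<in> X" and c: "c > 0"
    and near: "\<And>t. \<forall>\<^sub>F k in sequentially. f ((T ^^ t) (W k)) \<le> c / 2"
    and far: "\<And>J. \<forall>\<^sub>F k in sequentially. \<forall>j\<le>J. 3 * c \<le> f ((T ^^ (m k + j)) (W k))"
    and rec: "\<And>F d. finite F \<Longrightarrow> d > 0 \<Longrightarrow> \<exists>L. \<forall>n. \<exists>r\<ge>n. r \<le> n + L \<and> (\<forall>k\<in>F. dist ((T ^^ r) (W k)) (W k) < d)"
  shows "exp_separated X T f c n"
proof -
  define g where "g k t = f ((T ^^ t) (W k))" for k t
  \<comment> \<open>The times in \<open>S\<close> shatter \<open>F\<close>: each subset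
    \<open>I\<close> is the set of far points at some time. The bound on \<gamma> lets values at
    most \<open>c / 2\<close> count as near and values at least \<open>3 * c\<close> count as
    far.\<close>
  have "\<exists>F S \<gamma>. finite F \<and> card F = K \<and> finite S \<and> \<gamma> > 0 \<and> \<gamma> \<le> c / 2 \<and>
     (\<forall>I. \<exists>t\<in>S. \<forall>k\<in>F. if k \<in> I then 2 * c + \<gamma> \<le> g k t else g k t \<le> c - \<gamma>)" for K
  proof (induction K)
    case 0
    show ?case using c by (intro exI[of _ "{}"] exI[of _ "{0}"] exI[of _ "c / 2"]) auto
  next
    case (Suc K)
    then obtain F S \<gamma> where F: "finite F" "card F = K" and S: "finite S" and \<gamma>: "\<gamma> > 0" "\<gamma> \<le> c / 2" and
      cut: "\<And>I. \<exists>t\<in>S. \<forall>k\<in>F. if k \<in> I then 2 * c + \<gamma> \<le> g k t else g k t \<le> c - \<gamma>" by blast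
    define M where "M = Max (insert 0 S)"
    have SM: "t \<le> M" if "t \<in> S" for t using that S by (simp add: M_def)
    obtain d where d: "d > 0" "\<And>x z i. x \<in> X \<Longrightarrow> z \<in> X \<Longrightarrow> dist x z < d \<Longrightarrow> i \<le> M \<Longrightarrow> dist (f ((T ^^ i) x)) (f ((T ^^ i) z)) < \<gamma> / 2"
      using dyn_sys_equicontinuous_upto[OF D f, of "\<gamma> / 2" M] \<gamma> by auto
    obtain L where L: "\<And>n. \<exists>r\<ge>n. r \<le> n + L \<and> (\<forall>k\<in>F. dist ((T ^^ r) (W k)) (W k) < d)"
      using rec[OF F(1) d(1)] by blast
    have "\<forall>\<^sub>F k in sequentially. \<forall>t\<in>S. g k t \<le> c / 2"
      unfolding g_def using S near by (intro eventually_ball_finite) auto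
    \<comment> \<open>The far window has room for a return time \<open>r\<close> within
      \<open>L\<close> of \<open>m k\<close>, followed by all of \<open>S\<close>, whose largest
      element is at most \<open>M\<close>.\<close>
    then have "\<forall>\<^sub>F k in sequentially. (\<forall>t\<in>S. g k t \<le> c / 2) \<and> (\<forall>j\<le>L + M. 3 * c \<le> g k (m k + j))"
      using far[of "L + M"] unfolding g_def by (rule eventually_conj)
    then obtain k where k: "\<And>t. t \<in> S \<Longrightarrow> g k t \<le> c / 2" "\<And>j. j \<le> L + M \<Longrightarrow> 3 * c \<le> g k (m k + j)"
      by (metis (mono_tags, lifting) eventually_sequentially order_refl)
    obtain r where r: "r \<ge> m k" "r \<le> m k + L" "\<And>k. k \<in> F \<Longrightarrow> dist ((T ^^ r) (W k)) (W k) < d"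
      using L[of "m k"] by blast
    have ret: "\<bar>g i (r + t) - g i t\<bar> < \<gamma> / 2" if "i \<in> F" "t \<in> S" for i t
    proof -
      have "dist (f ((T ^^ t) ((T ^^ r) (W i)))) (f ((T ^^ t) (W i))) < \<gamma> / 2"
        using that W SM r(3) by (intro d(2)) (auto simp: dyn_sys_iter_in[OF D])
      moreover have "(T ^^ t) ((T ^^ r) (W i)) = (T ^^ (r + t)) (W i)" by (simp add: funpow_add add.commute[of r])
      ultimately show ?thesis by (simp add: g_def dist_real_def)
    qed
    have kfar: "3 * c \<le> g k (r + t)" if "t \<in> S" for t
      using k(2)[of "r + t - m k"] r SM[OF that] by simp
    \<comment> \<open>The pattern in which all of \<open>F\<close> is far occurs at a time in
      \<open>S\<close>, where the new point is near.\<close>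
    have "k \<notin> F"
    proof
      assume "k \<in> F"
      then obtain t where "t \<in> S" "2 * c + \<gamma> \<le> g k t" using cut[of F] by auto
      then show False using k(1)[of t] c \<gamma> by simp
    qed
    then have "card (insert k F) = Suc K" using F by simp
    moreover have "\<exists>t\<in>S \<union> (\<lambda>t. r + t) ` S. \<forall>i\<in>insert k F. if i \<in> I then 2 * c + \<gamma> / 2 \<le> g i t else g i t \<le> c - \<gamma> / 2" for I
    proof -
      obtain t where t: "t \<in> S" "\<And>i. i \<in> F \<Longrightarrow> if i \<in> I then 2 * c + \<gamma> \<le> g i t else g i t \<le> c - \<gamma>"
        using cut[of I] by blast
      show ?thesis
      proof (cases "k \<in> I")
        case True
        have "if i \<in> I then 2 * c + \<gamma> / 2 \<le> g i (r + t) else g i (r + t) \<le> c - \<gamma> / 2" if "i \<in> F" for i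
          using ret[OF that t(1)] t(2)[OF that] by (auto simp: abs_if split: if_splits)
        then show ?thesis using True kfar[OF t(1)] \<gamma> t(1) c by (intro bexI[of _ "r + t"]) auto
      next
        case False
        have "if i \<in> I then 2 * c + \<gamma> / 2 \<le> g i t else g i t \<le> c - \<gamma> / 2" if "i \<in> F" for i
          using t(2)[OF that] \<gamma> by (auto split: if_splits)
        then show ?thesis using False k(1)[OF t(1)] \<gamma> t(1) by (intro bexI[of _ t]) auto
      qed
    qed
    ultimately show ?case using F S \<gamma>
      by (intro exI[of _ "insert k F"] exI[of _ "S \<union> (\<lambda>t. r + t) ` S"] exI[of _ "\<gamma> / 2"]) auto
  qed
  \<comment> \<open>Label the \<open>2 ^ n\<close> shattered points by the subsets of
    \<open>{..<n}\<close>. For each bit \<open>b\<close> one time realises the pattern given by that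
    bit, so \<open>n\<close> times separate all points.\<close>
  from this[of "2 ^ n"] obtain F S \<gamma> where F: "finite F" "card F = 2 ^ n" and \<gamma>: "\<gamma> > 0" and
    cut: "\<And>I. \<exists>t\<in>S. \<forall>k\<in>F. if k \<in> I then 2 * c + \<gamma> \<le> g k t else g k t \<le> c - \<gamma>" by blast
  have "\<exists>h. bij_betw h F (Pow {..<n})"
    using F by (intro finite_same_card_bij) (auto simp: card_Pow)
  then obtain h where h: "inj_on h F" "\<And>k. k \<in> F \<Longrightarrow> h k \<subseteq> {..<n}" by (auto simp: bij_betw_def)
  obtain t where t: "\<And>b k. k \<in> F \<Longrightarrow> if b \<in> h k then 2 * c + \<gamma> \<le> g k (t b) else g k (t b) \<le> c - \<gamma>"
    using cut[of "{k. b \<in> h k}" for b] by (simp, metis)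
  show ?thesis
  proof (rule exp_separatedI[where x = W and A = "t ` {..<n}", OF W F])
    show "card (t ` {..<n}) \<le> n" using card_image_le[of "{..<n}" t] by simp
    fix k k' assume k: "k \<in> F" "k' \<in> F" "k \<noteq> k'"
    then have "h k \<noteq> h k'" using h(1) by (meson inj_onD)
    then obtain b where b: "b \<in> h k \<longleftrightarrow> b \<notin> h k'" by blast
    then have "b < n" using h(2) k by blast
    moreover have "c \<le> \<bar>g k (t b) - g k' (t b)\<bar>" using t[OF k(1), of b] t[OF k(2), of b] b c \<gamma> by (auto split: if_splits)
    ultimately show "\<exists>t\<in>t ` {..<n}. c \<le> \<bar>f ((T ^^ t) (W k)) - f ((T ^^ t) (W k'))\<bar>"
      unfolding g_def by blast
  qed (use c in auto)
qed

section \<open>Separated families and sequence entropy\<close>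

text \<open>The indices enumerated into \<open>G\<close> form a downward closed set with
  \<open>card G\<close> elements. This makes each concatenated sampling set a prefix of the final
  sequence.\<close>

lemma enumerate_initial_segment:
  fixes A G :: "nat set"
  assumes A: "infinite A" and G: "finite G" "G \<subseteq> A" and less: "\<And>a g. a \<in> A - G \<Longrightarrow> g \<in> G \<Longrightarrow> g < a"
  shows "enumerate A ` {..<card G} = G"
proof -
  have mono: "strict_mono (enumerate A)" by (rule strict_mono_enumerate[OF A])
  define I where "I = {i. enumerate A i \<in> G}"
  have im: "enumerate A ` I = G" using range_enumerate[OF A] G(2) by (auto simp: I_def)
  have inj: "inj_on (enumerate A) I" using mono strict_mono_imp_inj_on by (metis inj_on_subset subset_UNIV)
  have fin: "finite I" using im inj G(1) by (metis finite_image_iff)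
  have card: "card I = card G" using card_image[OF inj] im by simp
  have down: "j \<in> I" if "i \<in> I" "j < i" for i j
  proof (rule ccontr)
    assume "j \<notin> I"
    then have "enumerate A i < enumerate A j" using that(1) less enumerate_in_set[OF A] by (auto simp: I_def)
    with strict_monoD[OF mono that(2)] show False by simp
  qed
  have "I = {..<card I}"
  proof (cases "I = {}")
    case False
    then have "Max I \<in> I" using fin by simp
    then have "I = {..Max I}" using fin down by (force simp: le_less dest: Max_ge)
    then show ?thesis by (metis card_atMost lessThan_Suc_atMost)
  qed simp
  then show ?thesis using im card by metis
qed

text \<open>At time \<open>t\<close> the two pairs share a member of the product cover formed from
  \<U>. Members may overlap, so this need not be transitive.\<close>

definition same_cell :: "('a \<Rightarrow> 'a) \<Rightarrow> 'a set set \<Rightarrow> nat \<Rightarrow> 'a \<times> 'a \<Rightarrow> 'a \<times> 'a \<Rightarrow> bool" where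
  "same_cell T \<U> t v w \<longleftrightarrow> (\<exists>A\<in>\<U>. (T ^^ t) (fst v) \<in> A \<and> (T ^^ t) (fst w) \<in> A) \<and>
     (\<exists>B\<in>\<U>. (T ^^ t) (snd v) \<in> B \<and> (T ^^ t) (snd w) \<in> B)"

definition cover_separated :: "'a set \<Rightarrow> ('a \<Rightarrow> 'a) \<Rightarrow> 'a set set \<Rightarrow> nat set \<Rightarrow> ('a \<times> 'a) set \<Rightarrow> bool" where
  "cover_separated X T \<U> S E \<longleftrightarrow> finite E \<and> E \<subseteq> X \<times> X \<and>
    (\<forall>v\<in>E. \<forall>w\<in>E. v \<noteq> w \<longrightarrow> (\<exists>t\<in>S. \<not> same_cell T \<U> t v w))"

lemma join_cover_properties:
  assumes D: "dyn_sys X T" and U: "open_cover X \<U>"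
  shows "finite (join_cover X T t \<U> n)" "\<Union> (join_cover X T t \<U> n) = X"
proof -
  let ?g = "\<lambda>f. {x \<in> X. \<forall>i<n. (T ^^ t i) x \<in> f i}"
  have "join_cover X T t \<U> n \<subseteq> ?g ` (PiE {..<n} (\<lambda>_. \<U>))"
  proof
    fix C assume "C \<in> join_cover X T t \<U> n"
    then obtain f where f: "C = ?g f" "\<forall>i<n. f i \<in> \<U>" by (auto simp: join_cover_def)
    \<comment> \<open>Only the values of \<open>f\<close> below \<open>n\<close> matter, so finitely
      many choice functions give all members of the join.\<close>
    have "C = ?g (restrict f {..<n})" using f(1) by auto
    moreover have "restrict f {..<n} \<in> PiE {..<n} (\<lambda>_. \<U>)" using f(2) by auto
    ultimately show "C \<in> ?g ` (PiE {..<n} (\<lambda>_. \<U>))" by blast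
  qed
  moreover have "finite (PiE {..<n} (\<lambda>_. \<U>))" using U by (intro finite_PiE) (auto simp: open_cover_def)
  ultimately show "finite (join_cover X T t \<U> n)" by (meson finite_imageI finite_subset)
  show "\<Union> (join_cover X T t \<U> n) = X"
  proof (intro equalityI subsetI)
    fix x assume x: "x \<in> X"
    have "\<forall>i. \<exists>A\<in>\<U>. (T ^^ t i) x \<in> A"
      using U dyn_sys_iter_in[OF D x] unfolding open_cover_def by blast
    then obtain f where f: "\<And>i. f i \<in> \<U>" "\<And>i. (T ^^ t i) x \<in> f i" by metis
    then have "?g f \<in> join_cover X T t \<U> n" "x \<in> ?g f" using x by (auto simp: join_cover_def)
    then show "x \<in> \<Union> (join_cover X T t \<U> n)" by blast
  qed (auto simp: join_cover_def)
qed

text \<open>The products of members of a minimal subcover cover \<open>X \<times> X\<close>, and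
  each contains at most one point of a separated set; hence the square.\<close>

lemma cover_separated_card_le:
  assumes D: "dyn_sys X T" and U: "open_cover X \<U>" and sep: "cover_separated X T \<U> (t ` {..<n}) E"
  shows "card E \<le> (min_subcover X (join_cover X T t \<U> n))\<^sup>2"
proof -
  let ?C = "join_cover X T t \<U> n"
  have "\<exists>V\<subseteq>?C. finite V \<and> card V = min_subcover X ?C \<and> \<Union> V = X"
    unfolding min_subcover_def
    by (rule LeastI_ex) (use join_cover_properties[OF D U, of t n] in blast)
  then obtain V where V: "V \<subseteq> ?C" "finite V" "card V = min_subcover X ?C" "\<Union> V = X" by blast
  then have "\<forall>x\<in>X. \<exists>A\<in>V. x \<in> A" by blast
  then obtain v where v: "\<And>x. x \<in> X \<Longrightarrow> v x \<in> V" "\<And>x. x \<in> X \<Longrightarrow> x \<in> v x" by metis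
  have "inj_on (\<lambda>w. (v (fst w), v (snd w))) E"
  proof (rule inj_onI, rule ccontr)
    fix a b assume ab: "a \<in> E" "b \<in> E" "(v (fst a), v (snd a)) = (v (fst b), v (snd b))" "a \<noteq> b"
    have X: "fst a \<in> X" "snd a \<in> X" "fst b \<in> X" "snd b \<in> X"
      using ab(1,2) sep by (auto simp: cover_separated_def)
    have "v (fst a) \<in> ?C" "v (snd a) \<in> ?C" using v(1) X V(1) by auto
    then obtain f g where f: "v (fst a) = {x \<in> X. \<forall>i<n. (T ^^ t i) x \<in> f i}" "\<forall>i<n. f i \<in> \<U>"
      and g: "v (snd a) = {x \<in> X. \<forall>i<n. (T ^^ t i) x \<in> g i}" "\<forall>i<n. g i \<in> \<U>"
      unfolding join_cover_def by blast
    have *: "fst a \<in> v (fst a)" "fst b \<in> v (fst a)" "snd a \<in> v (snd a)" "snd b \<in> v (snd a)"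
      using v(2) X ab(3) by auto
    have "same_cell T \<U> s a b" if s: "s \<in> t ` {..<n}" for s
    proof -
      obtain i where i: "i < n" "s = t i" using s by blast
      have "f i \<in> \<U>" "(T ^^ s) (fst a) \<in> f i" "(T ^^ s) (fst b) \<in> f i"
        using f i * by auto
      moreover have "g i \<in> \<U>" "(T ^^ s) (snd a) \<in> g i" "(T ^^ s) (snd b) \<in> g i"
        using g i * by auto
      ultimately show ?thesis unfolding same_cell_def by blast
    qed
    then show False using sep ab unfolding cover_separated_def by blast
  qed
  then have "card E \<le> card (V \<times> V)"
    by (rule card_inj_on_le) (use v sep V(2) in \<open>auto simp: cover_separated_def\<close>)
  then show ?thesis using V(3) by (simp add: card_cartesian_product power2_eq_square)
qed

text \<open>Sort the points by their itineraries up to time \<open>M\<close>. Points with equal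
  early itineraries can be separated only later, and a largest class loses at most the number of
  itineraries as a factor. This number depends on \<open>M\<close> but not on \<open>S\<close> or
  \<open>E\<close>.\<close>

lemma cover_separated_late:
  assumes D: "dyn_sys X T" and U: "open_cover X \<U>"
  shows "\<exists>Q::nat. \<forall>S E. cover_separated X T \<U> S E \<longrightarrow> (\<exists>E'. cover_separated X T \<U> (S \<inter> {M<..}) E' \<and> card E \<le> Q * card E')"
proof -
  have "\<forall>x\<in>X. \<exists>A\<in>\<U>. x \<in> A" using U by (auto simp: open_cover_def)
  then obtain c where c: "\<And>x. x \<in> X \<Longrightarrow> c x \<in> \<U>" "\<And>x. x \<in> X \<Longrightarrow> x \<in> c x" by metis
  define N where "N = PiE {..M} (\<lambda>_. \<U> \<times> \<U>)"
  have N: "finite N" using U unfolding N_def by (intro finite_PiE) (auto simp: open_cover_def)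
  \<comment> \<open>The fixed choice \<open>c\<close> of a cover member turns overlapping cells into
    unambiguous names; equal names at a time imply a shared cell.\<close>
  define nm where "nm w = (\<lambda>i\<in>{..M}. (c ((T ^^ i) (fst w)), c ((T ^^ i) (snd w))))" for w
  show ?thesis
  proof (intro exI[of _ "card N"] allI impI)
    fix S E assume sep: "cover_separated X T \<U> S E"
    have fE: "finite E" and EX: "E \<subseteq> X \<times> X" using sep by (auto simp: cover_separated_def)
    have "nm ` E \<subseteq> N" using EX c(1) dyn_sys_iter_in[OF D] by (fastforce simp: nm_def N_def)
    then have le: "card (nm ` E) \<le> card N" using N by (rule card_mono[rotated])
    define fib where "fib q = {w \<in> E. nm w = q}" for q
    have "cover_separated X T \<U> (S \<inter> {M<..}) (fib q)" for q
    proof -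
      have "\<exists>t\<in>S \<inter> {M<..}. \<not> same_cell T \<U> t v w"
        if "v \<in> fib q" "w \<in> fib q" "v \<noteq> w" for v w
      proof -
        have vw: "v \<in> E" "w \<in> E" "nm v = nm w" using that by (auto simp: fib_def)
        then obtain t where t: "t \<in> S" "\<not> same_cell T \<U> t v w"
          using sep \<open>v \<noteq> w\<close> unfolding cover_separated_def by blast
        have "t > M"
        proof (rule ccontr)
          assume "\<not> t > M"
          then have "nm v t = nm w t" "t \<le> M" using vw(3) by auto
          then have "c ((T ^^ t) (fst v)) = c ((T ^^ t) (fst w))" "c ((T ^^ t) (snd v)) = c ((T ^^ t) (snd w))"
            by (auto simp: nm_def)
          moreover have "fst v \<in> X" "snd v \<in> X" "fst w \<in> X" "snd w \<in> X" using vw(1,2) EX by auto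
          ultimately have "same_cell T \<U> t v w"
            using c dyn_sys_iter_in[OF D] unfolding same_cell_def by metis
          with t(2) show False by blast
        qed
        then show ?thesis using t by blast
      qed
      then show ?thesis using fE EX unfolding cover_separated_def fib_def by auto
    qed
    moreover have "\<exists>q. card E \<le> card N * card (fib q)"
    proof (rule ccontr)
      assume no: "\<not> ?thesis"
      then have "E \<noteq> {}" by force
      have "card N * card E = (\<Sum>q\<in>nm ` E. card N * card (fib q))"
        using sum.image_gen[OF fE, of "\<lambda>_. card N" nm] by (simp add: fib_def mult.commute)
      also have "\<dots> \<le> (\<Sum>q\<in>nm ` E. card E - 1)"
      proof (rule sum_mono)
        fix q
        have "card N * card (fib q) < card E" using no not_le by blast
        then show "card N * card (fib q) \<le> card E - 1" by linarith
      qed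
      also have "\<dots> \<le> card N * (card E - 1)" using le by simp
      finally have "card N * card E \<le> card N * (card E - 1)" .
      moreover have "card (nm ` E) > 0" "card E > 0" using fE \<open>E \<noteq> {}\<close> by (auto simp: card_gt_0_iff)
      ultimately show False using le by simp
    qed
    ultimately show "\<exists>E'. cover_separated X T \<U> (S \<inter> {M<..}) E' \<and> card E \<le> card N * card E'" by blast
  qed
qed

text \<open>The sampling sets of growing size are concatenated into one sequence; discarding the times up to
  \<open>M\<close> from a sampling set costs only a bounded factor.\<close>
lemma seq_entropy_pos:
  assumes D: "dyn_sys X T" and U: "open_cover X \<U>"
    and sep: "\<And>n. \<exists>S E. finite S \<and> card S \<le> n \<and> card E = 2 ^ n \<and> cover_separated X T \<U> S E"
  shows "\<exists>t. strict_mono t \<and> seq_entropy X T t > 0"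
proof -
  define P where "P G \<longleftrightarrow> finite G" for G :: "nat set"
  \<comment> \<open>The exponent \<open>3\<close> comes from keeping at least \<open>2 ^ l\<close>
    points while using at most \<open>l\<close> old and \<open>2 * l\<close> new times.\<close>
  define R where "R G G' \<longleftrightarrow> G \<subset> G' \<and> (\<forall>a\<in>G' - G. \<forall>g\<in>G. g < a) \<and>
    (\<exists>E. cover_separated X T \<U> G' E \<and> 2 ^ card G' \<le> (card E) ^ 3)" for G G'
  have "\<exists>G. \<forall>k::nat. P (G k) \<and> R (G k) (G (Suc k))"
  proof (rule dependent_nat_choice)
    show "\<exists>G. P G" by (auto simp: P_def)
    fix G :: "nat set" and k :: nat assume "P G"
    define M where "M = Max (insert 0 G)"
    have GM: "g \<le> M" if "g \<in> G" for g using that \<open>P G\<close> by (simp add: M_def P_def)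
    obtain Q :: nat where Q: "\<And>S E. cover_separated X T \<U> S E \<Longrightarrow> \<exists>E'. cover_separated X T \<U> (S \<inter> {M<..}) E' \<and> card E \<le> Q * card E'"
      using cover_separated_late[OF D U, of M] by blast
    \<comment> \<open>This exceeds the number of old times and makes \<open>2 ^ l\<close> exceed the
      loss factor \<open>Q\<close>; starting with \<open>2 ^ (2 * l)\<close> points therefore leaves
      at least \<open>2 ^ l\<close>.\<close>
    define l where "l = Suc (card G + Q)"
    obtain S E where S: "finite S" "card S \<le> 2 * l" "card E = 2 ^ (2 * l)" "cover_separated X T \<U> S E"
      using sep by blast
    obtain E' where E': "cover_separated X T \<U> (S \<inter> {M<..}) E'" "card E \<le> Q * card E'" using Q[OF S(4)] by blast
    have "Q \<le> 2 ^ l" using less_exp[of l] by (simp add: l_def)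
    then have "2 ^ l * 2 ^ l \<le> 2 ^ l * card E'"
      using E'(2) S(3) by (metis mult_2 mult_le_mono1 order_trans power_add)
    then have big: "2 ^ l \<le> card E'" by simp
    define G' where "G' = G \<union> (S \<inter> {M<..})"
    have "cover_separated X T \<U> G' E'" using E'(1) unfolding cover_separated_def G'_def by blast
    moreover have "card G' \<le> 3 * l"
    proof -
      have "card G' \<le> card G + card (S \<inter> {M<..})" unfolding G'_def by (rule card_Un_le)
      also have "card (S \<inter> {M<..}) \<le> card S" using S(1) by (intro card_mono) auto
      finally show ?thesis using S(2) by (simp add: l_def)
    qed
    then have "(2::nat) ^ card G' \<le> (2 ^ l) ^ 3"
      unfolding power_mult[symmetric] by (intro power_increasing) (auto simp: mult.commute)
    then have "2 ^ card G' \<le> card E' ^ 3" by (rule order_trans[OF _ power_mono[OF big]]) simp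
    moreover have "S \<inter> {M<..} \<noteq> {}"
    proof
      assume "S \<inter> {M<..} = {}"
      then have *: "\<forall>v\<in>E'. \<forall>w\<in>E'. v = w" using E'(1) unfolding cover_separated_def by blast
      have "card E' \<le> Suc 0" using E'(1) * by (subst card_le_Suc0_iff_eq) (auto simp: cover_separated_def)
      moreover have "(2::nat) ^ l \<ge> 2" by (simp add: l_def)
      ultimately show False using big by simp
    qed
    moreover have "\<forall>a\<in>G' - G. \<forall>g\<in>G. g < a" using GM unfolding G'_def by force
    ultimately have "R G G'" using GM unfolding R_def G'_def by fastforce
    moreover have "P G'" using \<open>P G\<close> S(1) by (simp add: P_def G'_def)
    ultimately show "\<exists>G'. P G' \<and> R G G'" by blast
  qed
  then obtain G where G: "\<And>k. finite (G k)" "\<And>k. R (G k) (G (Suc k))" by (auto simp: P_def)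
  have sub: "G i \<subseteq> G j" if "i \<le> j" for i j
    by (rule lift_Suc_mono_le[OF _ that]) (use G(2) in \<open>auto simp: R_def\<close>)
  have card: "k \<le> card (G k)" for k
  proof (induction k)
    case (Suc k)
    have "card (G k) < card (G (Suc k))" using G by (intro psubset_card_mono) (auto simp: R_def)
    then show ?case using Suc by simp
  qed simp
  have later: "\<forall>a\<in>G j - G i. \<forall>g\<in>G i. g < a" if "i \<le> j" for i j
    using that
  proof (induction j rule: dec_induct)
    case (step j)
    have "g < a" if "a \<in> G (Suc j) - G i" "g \<in> G i" for a g
      using that step.IH G(2)[of j] sub[OF step.hyps(1)] unfolding R_def by blast
    then show ?case by blast
  qed simp
  define A where "A = (\<Union>k. G k)"
  have inf: "infinite A"
  proof
    assume "finite A"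
    then have "card (G (Suc (card A))) \<le> card A" by (intro card_mono) (auto simp: A_def)
    then show False using card[of "Suc (card A)"] by simp
  qed
  define t where "t = enumerate A"
  have seg: "t ` {..<card (G k)} = G k" for k
    unfolding t_def
  proof (rule enumerate_initial_segment[OF inf G(1)])
    fix a g assume a: "a \<in> A - G k" "g \<in> G k"
    then obtain j where "a \<in> G j" by (auto simp: A_def)
    then have "a \<in> G (max j k) - G k" using a(1) sub[of j "max j k"] by auto
    moreover have "\<forall>a\<in>G (max j k) - G k. \<forall>g\<in>G k. g < a" by (rule later) simp
    ultimately show "g < a" using a(2) by blast
  qed (auto simp: A_def)
  let ?N = "\<lambda>n. min_subcover X (join_cover X T t \<U> n)"

  \<comment> \<open>The \<open>6\<close> combines the cube in \<open>R\<close> with the square that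
    arises in passing from pairs to covers of \<open>X\<close>.\<close>
  have low: "ln 2 / 6 \<le> ln (real (?N (card (G (Suc k))))) / real (card (G (Suc k)))" for k
  proof -
    let ?m = "card (G (Suc k))"
    obtain E where E: "cover_separated X T \<U> (G (Suc k)) E" "2 ^ ?m \<le> card E ^ 3"
      using G(2)[of k] unfolding R_def by blast
    have "card E \<le> (?N ?m)\<^sup>2" using cover_separated_card_le[OF D U] E(1) seg by metis
    then have "2 ^ ?m \<le> ((?N ?m)\<^sup>2) ^ 3" using E(2) power_mono[of "card E" _ 3] by (meson order_trans zero_le)
    then have *: "2 ^ ?m \<le> (?N ?m) ^ 6" by (simp flip: power_mult)
    then have pos: "?N ?m > 0" by (metis gr0I not_le power_0_left zero_less_numeral zero_less_power zero_neq_numeral)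
    have "(2::real) ^ ?m \<le> real (?N ?m) ^ 6" using * by (metis of_nat_le_iff of_nat_numeral of_nat_power)
    then have "ln ((2::real) ^ ?m) \<le> ln (real (?N ?m) ^ 6)" using pos by (subst ln_le_cancel_iff) auto
    then have "real ?m * ln 2 \<le> 6 * ln (real (?N ?m))" using pos by (simp add: ln_realpow)
    moreover have "real ?m > 0" using card[of "Suc k"] by simp
    ultimately show ?thesis by (simp add: field_simps)
  qed
  have "ereal (ln 2 / 6) \<le> seq_entropy_cover X T t \<U>"
  proof (rule ccontr)
    assume "\<not> ?thesis"
    then have "\<forall>\<^sub>F n in sequentially. ereal (ln (real (?N n)) / real n) < ereal (ln 2 / 6)"
      unfolding seq_entropy_cover_def not_le by (rule Limsup_lessD)
    then obtain n0 where "\<And>n. n \<ge> n0 \<Longrightarrow> ln (real (?N n)) / real n < ln 2 / 6"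
      by (auto simp: eventually_sequentially)
    moreover have "card (G (Suc n0)) \<ge> n0" using card[of "Suc n0"] by simp
    ultimately show False using low[of n0] by (meson not_le)
  qed
  also have "\<dots> \<le> seq_entropy X T t" unfolding seq_entropy_def using U by (intro SUP_upper) simp
  finally have "ereal (ln 2 / 6) \<le> seq_entropy X T t" .
  moreover have "ereal (ln 2 / 6) > 0" by simp
  ultimately have "seq_entropy X T t > 0" by (metis less_le_trans)
  then show ?thesis using strict_mono_enumerate[OF inf] t_def by blast
qed

text \<open>Cover \<open>X\<close> by balls finer than the modulus of uniform continuity of
  \<open>f\<close>. A gap \<open>e\<close> in \<open>f\<close> then separates the pairs with respect
  to the cover, so separated families of every size would force positive sequence entropy.\<close>

lemma null_not_exp_separated:
  fixes f :: "'a::metric_space \<times> 'a \<Rightarrow> real"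
  assumes D: "dyn_sys X T" and null: "null_system X T" and f: "continuous_on (X \<times> X) f" and "e > 0"
  shows "\<exists>n. \<not> exp_separated (X \<times> X) (map_prod T T) f e n"
proof (rule ccontr)
  assume no: "\<not> ?thesis"
  have "compact X" using D by (simp add: dyn_sys_def)
  then have "uniformly_continuous_on (X \<times> X) f"
    using f by (simp add: compact_Times compact_uniformly_continuous)
  then obtain \<rho> where \<rho>: "\<rho> > 0" "\<forall>w\<in>X \<times> X. \<forall>v\<in>X \<times> X. dist v w < \<rho> \<longrightarrow> dist (f v) (f w) < e"
    using \<open>e > 0\<close> unfolding uniformly_continuous_on_def by blast
  \<comment> \<open>Each cell has distances below \<open>\<rho> / 2\<close>, so agreement of cells
    in both coordinates bounds the distance of the pairs by \<rho>.\<close>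
  obtain F where F: "finite F" "X \<subseteq> (\<Union>x\<in>F. ball x (\<rho> / 4))"
    using \<open>\<rho> > 0\<close> \<open>compact X\<close> unfolding compact_eq_totally_bounded by (meson divide_pos_pos zero_less_numeral)
  define \<U> where "\<U> = (\<lambda>x. X \<inter> ball x (\<rho> / 4)) ` F"
  have U: "open_cover X \<U>" using F unfolding open_cover_def \<U>_def by (auto simp: openin_open_Int)
  have small: "dist a b < \<rho> / 2" if A: "A \<in> \<U>" "a \<in> A" "b \<in> A" for A a b
  proof -
    obtain x where "dist x a < \<rho> / 4" "dist x b < \<rho> / 4"
      using A unfolding \<U>_def by auto
    then show ?thesis using dist_triangle2[of a b x] by (simp add: dist_commute)
  qed
  have "\<exists>S E. finite S \<and> card S \<le> n \<and> card E = 2 ^ n \<and> cover_separated X T \<U> S E" for n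
  proof -
    obtain E S where E: "E \<subseteq> X \<times> X" "finite E" "card E = 2 ^ n" "finite S" "card S \<le> n"
      and sep: "\<forall>x\<in>E. \<forall>y\<in>E. x \<noteq> y \<longrightarrow> (\<exists>t\<in>S. e \<le> \<bar>f ((map_prod T T ^^ t) x) - f ((map_prod T T ^^ t) y)\<bar>)"
    proof -
      have "exp_separated (X \<times> X) (map_prod T T) f e n" using no by simp
      then show ?thesis unfolding exp_separated_def by (elim exE conjE) (rule that)
    qed
    have "\<exists>t\<in>S. \<not> same_cell T \<U> t v w"
      if vw: "v \<in> E" "w \<in> E" "v \<noteq> w" for v w
    proof -
      obtain t where t: "t \<in> S" "e \<le> \<bar>f ((map_prod T T ^^ t) v) - f ((map_prod T T ^^ t) w)\<bar>"
        using sep vw by blast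
      have XX: "(map_prod T T ^^ t) v \<in> X \<times> X" "(map_prod T T ^^ t) w \<in> X \<times> X"
        using E(1) vw dyn_sys_iter_in[OF dyn_sys_map_prod[OF D], of _ t] by auto
      have "\<rho> \<le> dist ((map_prod T T ^^ t) v) ((map_prod T T ^^ t) w)"
        using \<rho>(2)[rule_format, OF XX(2,1)] t(2) by (force simp: dist_real_def)
      also have "\<dots> = dist ((T ^^ t) (fst v), (T ^^ t) (snd v)) ((T ^^ t) (fst w), (T ^^ t) (snd w))"
        by (metis funpow_map_prod prod.collapse)
      also have "\<dots> \<le> dist ((T ^^ t) (fst v)) ((T ^^ t) (fst w)) + dist ((T ^^ t) (snd v)) ((T ^^ t) (snd w))"
        unfolding dist_Pair_Pair by (rule sqrt_sum_squares_le_sum) auto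
      finally show ?thesis using t(1) small unfolding same_cell_def by (smt (verit) field_sum_of_halves)
    qed
    then have "cover_separated X T \<U> S E" using E by (simp add: cover_separated_def)
    then show ?thesis using E by blast
  qed
  then obtain t where "strict_mono t" "seq_entropy X T t > 0" using seq_entropy_pos[OF D U] by blast
  then show False using null by (auto simp: null_system_def)
qed

section \<open>The proximal relation\<close>

lemma proximal_iff:
  "(x, y) \<in> proximal X T \<longleftrightarrow> x \<in> X \<and> y \<in> X \<and> (\<forall>e>0. \<exists>n\<ge>1. dist ((T ^^ n) x) ((T ^^ n) y) < e)"
proof -
  let ?d = "\<lambda>n. dist ((T ^^ n) x) ((T ^^ n) y)"
  have bdd: "bdd_below (?d ` {1..})" by (intro bdd_belowI[of _ 0]) auto
  have ge: "0 \<le> (INF n\<in>{1..}. ?d n)" by (intro cINF_greatest) auto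
  have aux: "a = 0 \<longleftrightarrow> (\<forall>e>0. a < e)" if "0 \<le> a" for a :: real
    using that by (auto simp: order_le_less)
  have "(INF n\<in>{1..}. ?d n) = 0 \<longleftrightarrow> (\<forall>e>0. (INF n\<in>{1..}. ?d n) < e)"
    using aux[OF ge] .
  also have "\<dots> \<longleftrightarrow> (\<forall>e>0. \<exists>n\<in>{1..}. ?d n < e)"
    using bdd by (subst cINF_less_iff) auto
  finally show ?thesis by (auto simp: proximal_def)
qed

lemma proximal_sym: "(x, y) \<in> proximal X T \<Longrightarrow> (y, x) \<in> proximal X T"
  by (simp add: proximal_iff dist_commute)

lemma proximal_refl: "x \<in> X \<Longrightarrow> (x, x) \<in> proximal X T"
  by (auto simp: proximal_iff)

lemma proximal_subset: "proximal X T \<subseteq> X \<times> X"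
  by (auto simp: proximal_def)

text \<open>The definition asks for positive times, whereas \<open>hit\<close> admits time
  \<open>0\<close>; one further application of \<open>T\<close> bridges this by uniform
  continuity.\<close>

lemma proximalI:
  assumes D: "dyn_sys X T" and xy: "x \<in> X" "y \<in> X" and hit: "\<And>e. e > 0 \<Longrightarrow> \<exists>n. dist ((T ^^ n) x) ((T ^^ n) y) < e"
  shows "(x, y) \<in> proximal X T"
  unfolding proximal_iff
proof (intro conjI allI impI xy)
  fix e :: real assume "e > 0"
  obtain d where d: "d > 0" "\<And>x y i. x \<in> X \<Longrightarrow> y \<in> X \<Longrightarrow> dist x y < d \<Longrightarrow> i \<le> 1 \<Longrightarrow> dist ((T ^^ i) x) ((T ^^ i) y) < e"
    using dyn_sys_equicontinuous_upto[OF D continuous_on_id \<open>e > 0\<close>, of 1] by auto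
  obtain n where "dist ((T ^^ n) x) ((T ^^ n) y) < d" using hit[OF d(1)] by blast
  from d(2)[OF _ _ this, of 1] have "dist ((T ^^ Suc n) x) ((T ^^ Suc n) y) < e"
    using xy dyn_sys_iter_in[OF D] by simp
  then show "\<exists>n\<ge>1. dist ((T ^^ n) x) ((T ^^ n) y) < e" by (intro exI[of _ "Suc n"]) simp
qed

text \<open>Once two orbits are close enough, equicontinuity of the first \<open>N\<close> iterates
  keeps them close for \<open>N\<close> further steps.\<close>

lemma proximal_thick:
  assumes D: "dyn_sys X T" and P: "(x, y) \<in> proximal X T" and "e > 0"
  shows "\<exists>v. \<forall>j\<le>N. dist ((T ^^ (v + j)) x) ((T ^^ (v + j)) y) < e"
proof -
  have xy: "x \<in> X" "y \<in> X" using P by (auto simp: proximal_iff)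
  obtain d where d: "d > 0" "\<And>x y i. x \<in> X \<Longrightarrow> y \<in> X \<Longrightarrow> dist x y < d \<Longrightarrow> i \<le> N \<Longrightarrow> dist ((T ^^ i) x) ((T ^^ i) y) < e"
    using dyn_sys_equicontinuous_upto[OF D continuous_on_id \<open>e > 0\<close>, of N] by auto
  obtain v where v: "dist ((T ^^ v) x) ((T ^^ v) y) < d" using P d(1) by (auto simp: proximal_iff)
  have "dist ((T ^^ j) ((T ^^ v) x)) ((T ^^ j) ((T ^^ v) y)) < e" if "j \<le> N" for j
    using d(2)[OF _ _ v that] xy dyn_sys_iter_in[OF D] by simp
  then show ?thesis by (intro exI[of _ v]) (simp add: funpow_add add.commute[of v])
qed

lemma proximal_iter:
  assumes D: "dyn_sys X T" and P: "(x, y) \<in> proximal X T"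
  shows "((T ^^ k) x, (T ^^ k) y) \<in> proximal X T"
proof (rule proximalI[OF D])
  show "(T ^^ k) x \<in> X" "(T ^^ k) y \<in> X" using P dyn_sys_iter_in[OF D] by (auto simp: proximal_iff)
  fix e :: real assume "e > 0"
  obtain v where "dist ((T ^^ (v + k)) x) ((T ^^ (v + k)) y) < e"
    using proximal_thick[OF D P \<open>e > 0\<close>, of k] by blast
  then show "\<exists>n. dist ((T ^^ n) ((T ^^ k) x)) ((T ^^ n) ((T ^^ k) y)) < e"
    by (intro exI[of _ v]) (simp add: funpow_add)
qed

lemma proximal_iter_prod:
  assumes "dyn_sys X T" "w \<in> proximal X T"
  shows "(map_prod T T ^^ k) w \<in> proximal X T"
  using proximal_iter[OF assms(1), of "fst w" "snd w" k] assms(2) by (metis funpow_map_prod prod.collapse)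

lemma dyn_sys_proximal:
  assumes D: "dyn_sys X T" and cl: "closed (proximal X T)"
  shows "dyn_sys (proximal X T) (map_prod T T)"
proof -
  have DD: "dyn_sys (X \<times> X) (map_prod T T)" by (rule dyn_sys_map_prod[OF D])
  have "compact (proximal X T)"
    using DD cl proximal_subset[of X T] unfolding dyn_sys_def by (metis compact_Int_closed inf.absorb_iff2)
  moreover have "continuous_on (proximal X T) (map_prod T T)"
    using DD proximal_subset[of X T] unfolding dyn_sys_def by (metis continuous_on_subset)
  moreover have "map_prod T T ` proximal X T \<subseteq> proximal X T"
    using proximal_iter_prod[OF D, of _ 1] by auto
  ultimately show ?thesis by (simp add: dyn_sys_def)
qed

text \<open>A closed proximal relation is a compact invariant subsystem, so the waiting time for an
  approach is bounded over all its pairs.\<close>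

lemma proximal_uniform_hitting:
  assumes D: "dyn_sys X T" and cl: "closed (proximal X T)" and "e > 0"
  shows "\<exists>L. \<forall>(x, y)\<in>proximal X T. \<exists>n\<le>L. dist ((T ^^ n) x) ((T ^^ n) y) < e"
proof -
  have "\<exists>L. \<forall>w\<in>proximal X T. \<exists>n\<le>L. dist (fst ((map_prod T T ^^ n) w)) (snd ((map_prod T T ^^ n) w)) < e"
  proof (rule dyn_sys_uniform_hitting[where f = "\<lambda>w. dist (fst w) (snd w)", OF dyn_sys_proximal[OF D cl]])
    show "continuous_on (proximal X T) (\<lambda>w. dist (fst w) (snd w))" by (intro continuous_intros)
    fix w assume "w \<in> proximal X T"
    then show "\<exists>n. dist (fst ((map_prod T T ^^ n) w)) (snd ((map_prod T T ^^ n) w)) < e"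
      using \<open>e > 0\<close> by (cases w) (auto simp: proximal_iff funpow_map_prod)
  qed
  then obtain L where L: "\<forall>w\<in>proximal X T. \<exists>n\<le>L. dist (fst ((map_prod T T ^^ n) w)) (snd ((map_prod T T ^^ n) w)) < e" by blast
  have "\<exists>n\<le>L. dist ((T ^^ n) x) ((T ^^ n) y) < e" if "(x, y) \<in> proximal X T" for x y
    using bspec[OF L that] by (simp add: funpow_map_prod)
  then show ?thesis by blast
qed

text \<open>The first pair stays close during a stretch of length \<open>L\<close>, and the second
  pair must come close somewhere within any such stretch.\<close>

lemma proximal_trans:
  assumes D: "dyn_sys X T" and cl: "closed (proximal X T)"
    and xy: "(x, y) \<in> proximal X T" and yz: "(y, z) \<in> proximal X T"
  shows "(x, z) \<in> proximal X T"
proof (rule proximalI[OF D])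
  have X: "x \<in> X" "y \<in> X" "z \<in> X" using xy yz by (auto simp: proximal_iff)
  then show "x \<in> X" "z \<in> X" by auto
  fix e :: real assume "e > 0"
  then have e2: "e / 2 > 0" by simp
  obtain L where L: "\<And>x y. (x, y) \<in> proximal X T \<Longrightarrow> \<exists>n\<le>L. dist ((T ^^ n) x) ((T ^^ n) y) < e / 2"
    using proximal_uniform_hitting[OF D cl e2] by blast
  obtain v where v: "\<And>j. j \<le> L \<Longrightarrow> dist ((T ^^ (v + j)) x) ((T ^^ (v + j)) y) < e / 2"
    using proximal_thick[OF D xy e2, of L] by blast
  obtain n where n: "n \<le> L" "dist ((T ^^ n) ((T ^^ v) y)) ((T ^^ n) ((T ^^ v) z)) < e / 2"
    using L[OF proximal_iter[OF D yz, of v]] by blast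
  have "dist ((T ^^ (v + n)) y) ((T ^^ (v + n)) z) < e / 2"
    using n(2) by (simp add: funpow_add add.commute[of v])
  then have "dist ((T ^^ (v + n)) x) ((T ^^ (v + n)) z) < e"
    using v[OF n(1)] dist_triangle_half_r[of _ _ e] by (metis dist_commute dist_triangle_half_l)
  then show "\<exists>n. dist ((T ^^ n) x) ((T ^^ n) z) < e" by blast
qed

text \<open>An orbit coming very near the proximal relation would shadow a proximal pair for
  \<open>L\<close> steps and so approach the diagonal, which would make the pair proximal.\<close>

lemma not_proximal_orbit_away:
  assumes D: "dyn_sys X T" and cl: "closed (proximal X T)" and v: "v \<in> X \<times> X" "v \<notin> proximal X T"
  shows "\<exists>c>0. \<forall>j. c \<le> infdist ((map_prod T T ^^ j) v) (proximal X T)"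
proof (rule ccontr)
  assume no: "\<not> ?thesis"
  let ?f = "\<lambda>w. dist (fst w) (snd w :: 'a)"
  have "(fst v, snd v) \<in> proximal X T"
  proof (rule proximalI[OF D])
    show "fst v \<in> X" "snd v \<in> X" using v by auto
    have ne: "proximal X T \<noteq> {}" using proximal_refl[of "fst v" X T] v(1) by auto
    fix e :: real assume "e > 0"
    then have e2: "e / 2 > 0" by simp
    obtain L where L: "\<And>x y. (x, y) \<in> proximal X T \<Longrightarrow> \<exists>n\<le>L. dist ((T ^^ n) x) ((T ^^ n) y) < e / 2"
      using proximal_uniform_hitting[OF D cl e2] by blast
    have "continuous_on (X \<times> X) ?f" by (intro continuous_intros)
    from dyn_sys_equicontinuous_upto[OF dyn_sys_map_prod[OF D] this e2, of L]
    obtain d where d: "d > 0" "\<And>w w' i. w \<in> X \<times> X \<Longrightarrow> w' \<in> X \<times> X \<Longrightarrow> dist w w' < d \<Longrightarrow> i \<le> L \<Longrightarrow>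
        dist (?f ((map_prod T T ^^ i) w)) (?f ((map_prod T T ^^ i) w')) < e / 2" by blast
    obtain j where j: "infdist ((map_prod T T ^^ j) v) (proximal X T) < d"
      using no d(1) by (meson not_le)
    then have "\<exists>w\<in>proximal X T. dist ((map_prod T T ^^ j) v) w < d"
      using ne unfolding infdist_notempty[OF ne] by (subst (asm) cINF_less_iff) (auto intro: bdd_belowI[of _ 0])
    then obtain w where w: "w \<in> proximal X T" "dist ((map_prod T T ^^ j) v) w < d" by blast
    obtain n where n: "n \<le> L" "?f ((map_prod T T ^^ n) w) < e / 2"
      using L[of "fst w" "snd w"] w(1) by (cases w) (auto simp: funpow_map_prod)
    have "dist (?f ((map_prod T T ^^ n) ((map_prod T T ^^ j) v))) (?f ((map_prod T T ^^ n) w)) < e / 2"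
      using w proximal_subset[of X T] v(1) dyn_sys_iter_in[OF dyn_sys_map_prod[OF D]] by (intro d(2) n(1)) auto
    then have "?f ((map_prod T T ^^ (n + j)) v) < e"
      using n(2) by (simp add: funpow_add dist_real_def abs_if split: if_splits)
    then show "\<exists>n. dist ((T ^^ n) (fst v)) ((T ^^ n) (snd v)) < e"
      by (intro exI[of _ "n + j"]) (cases v, simp add: funpow_map_prod)
  qed
  then show False using v by simp
qed

lemma exp_separated_mono: "exp_separated X T f e n \<Longrightarrow> X \<subseteq> Y \<Longrightarrow> exp_separated Y T f e n"
  unfolding exp_separated_def by (meson order_trans)

text \<open>Otherwise large averages give positive density to the proximal pairs at distance at
  least \<open>e / 2\<close>. A density recurrent pair among them has long stretches near the
  diagonal, and the resulting separated families contradict nullness.\<close>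

lemma proximal_mean_small:
  assumes D: "dyn_sys X T" and null: "null_system X T" and cl: "closed (proximal X T)" and "e > 0"
  shows "\<exists>n\<ge>1. \<forall>(x, y)\<in>proximal X T. (\<Sum>i<n. dist ((T ^^ i) x) ((T ^^ i) y)) \<le> e * real n"
proof (rule ccontr)
  assume no: "\<not> ?thesis"
  then have no': "\<not> (\<forall>(x, y)\<in>proximal X T. (\<Sum>i<n. dist ((T ^^ i) x) ((T ^^ i) y)) \<le> e * real n)" if "n \<ge> 1" for n
    using that by blast
  let ?f = "\<lambda>w. dist (fst w) (snd w :: 'a)" and ?S = "map_prod T T" and ?P = "proximal X T"
  note DP = dyn_sys_proximal[OF D cl]
  have f: "continuous_on A ?f" for A by (intro continuous_intros)
  have "bounded X" using D by (simp add: dyn_sys_def compact_imp_bounded)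
  then obtain B where B: "\<And>x y. x \<in> X \<Longrightarrow> y \<in> X \<Longrightarrow> dist x y \<le> B" "B > 0"
    unfolding bounded_two_points by (metis dual_order.trans gt_ex less_imp_le linorder_not_less)
  define U where "U = {w \<in> ?P. e / 2 \<le> ?f w}"
  have "closed U"
    unfolding U_def using continuous_closed_preimage[OF f cl, of "{e / 2..}"]
    by (simp add: Int_def vimage_def)
  have "pos_density ?P ?S U"
    unfolding pos_density_def
  \<comment> \<open>A Markov estimate: times outside \<open>U\<close> contribute at most
    \<open>e / 2\<close> each to the sum, times in \<open>U\<close> at most an additional
    \<open>B\<close>.\<close>
  proof (intro exI[of _ "e / (2 * B)"] conjI allI)
    show "e / (2 * B) > 0" using \<open>e > 0\<close> B(2) by simp
    fix N
    obtain x y where xy: "(x, y) \<in> ?P" "e * real (Suc N) < (\<Sum>i<Suc N. dist ((T ^^ i) x) ((T ^^ i) y))"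
    proof -
      have "\<not> (\<forall>(x, y)\<in>?P. (\<Sum>i<Suc N. dist ((T ^^ i) x) ((T ^^ i) y)) \<le> e * real (Suc N))"
        by (rule no') simp
      then show ?thesis using that by (auto simp: not_le simp del: sum.lessThan_Suc)
    qed
    have X: "x \<in> X" "y \<in> X" using xy by (auto simp: proximal_iff)
    let ?n = "Suc N" and ?I = "{i. i < Suc N \<and> (?S ^^ i) (x, y) \<in> U}"
    have "(\<Sum>i<?n. dist ((T ^^ i) x) ((T ^^ i) y)) \<le> (\<Sum>i<?n. e / 2 + (if i \<in> ?I then B else 0))"
    proof (rule sum_mono)
      fix i assume "i \<in> {..<?n}"
      show "dist ((T ^^ i) x) ((T ^^ i) y) \<le> e / 2 + (if i \<in> ?I then B else 0)"
        using proximal_iter[OF D xy(1), of i] \<open>i \<in> {..<?n}\<close> \<open>e > 0\<close> X B(1)[of "(T ^^ i) x" "(T ^^ i) y"] dyn_sys_iter_in[OF D]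
        by (auto simp: U_def funpow_map_prod)
    qed
    also have "\<dots> = real ?n * (e / 2) + B * real (visits ?S U (x, y) ?n)"
    proof -
      have "{..<?n} \<inter> ?I = ?I" by auto
      then show ?thesis by (simp add: sum.distrib sum.If_cases visits_def Int_def del: sum.lessThan_Suc)
    qed
    also have "real ?n * (e / 2) = e * real ?n / 2" by simp
    finally have "e * real ?n / 2 \<le> B * real (visits ?S U (x, y) ?n)"
      using xy(2) by linarith
    then have "e / (2 * B) * real ?n \<le> real (visits ?S U (x, y) ?n)"
      using B(2) by (simp add: field_simps)
    then show "\<exists>n\<ge>N. \<exists>w\<in>?P. e / (2 * B) * real n \<le> real (visits ?S U w n)"
      using xy(1) by (intro exI[of _ ?n]) auto
  qed
  then obtain y where y: "y \<in> U" "\<And>d. d > 0 \<Longrightarrow> \<exists>c>0. \<forall>n. c * real n \<le> real (card {i. i < n \<and> dist ((?S ^^ i) y) y < d})"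
    using density_recurrent_point[OF DP \<open>closed U\<close>] by (auto simp: U_def)
  have yP: "y \<in> ?P" "e / 2 \<le> ?f y" using y(1) by (auto simp: U_def)
  \<comment> \<open>The gap \<open>e / 5\<close> satisfies \<open>2 * (e / 5) < e / 2\<close>, as
    the doubling construction requires.\<close>
  have "exp_separated ?P ?S ?f (e / 5) n" for n
  proof (rule density_recurrent_exp_separated[OF DP f yP(1) _ _ y(2)])
    show "2 * (e / 5) < ?f y" "e / 5 > 0" using yP(2) \<open>e > 0\<close> by auto
    show "\<exists>v. \<forall>j\<le>N. ?f ((?S ^^ (v + j)) y) < e / 5" for N
      using proximal_thick[OF D, of "fst y" "snd y" "e / 5" N] yP(1) \<open>e > 0\<close>
      by (cases y) (simp add: funpow_map_prod)
  qed
  then have "exp_separated (X \<times> X) ?S ?f (e / 5) n" for n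
    using exp_separated_mono proximal_subset by blast
  then show False using null_not_exp_separated[OF D null f, of "e / 5"] \<open>e > 0\<close> by auto
qed

section \<open>A minimal idempotent of the Ellis semigroup\<close>

text \<open>Zorn's lemma applied to complements. The intersection of a chain is nonempty by the
  finite intersection property, because a finite subchain has a least member.\<close>

lemma compact_minimal_set:
  assumes C: "compact C" and mem: "\<And>S. S \<in> \<A> \<Longrightarrow> closed S \<and> S \<subseteq> C \<and> S \<noteq> {}" and ne: "\<A> \<noteq> {}"
    and inter: "\<And>\<D>. \<D> \<subseteq> \<A> \<Longrightarrow> \<D> \<noteq> {} \<Longrightarrow> \<Inter>\<D> \<noteq> {} \<Longrightarrow> \<Inter>\<D> \<in> \<A>"
  shows "\<exists>M\<in>\<A>. \<forall>S\<in>\<A>. S \<subseteq> M \<longrightarrow> S = M"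
proof -
  have "\<exists>M\<in>uminus ` \<A>. \<forall>S\<in>uminus ` \<A>. M \<subseteq> S \<longrightarrow> S = M"
  proof (rule subset_Zorn_nonempty)
    fix \<C> assume \<C>: "\<C> \<noteq> {}" "subset.chain (uminus ` \<A>) \<C>"
    define \<D> where "\<D> = uminus ` \<C>"
    have sub: "\<D> \<subseteq> \<A>" using \<C>(2) by (auto simp: \<D>_def subset_chain_def)
    have tot: "A \<subseteq> B \<or> B \<subseteq> A" if "A \<in> \<D>" "B \<in> \<D>" for A B
      using that \<C>(2) unfolding \<D>_def subset_chain_def by blast
    have fin: "\<Inter>F \<in> F" if "finite F" "F \<noteq> {}" "F \<subseteq> \<D>" for F
      using that
    proof (induction F rule: finite_ne_induct)
      case (insert A F)
      then have F: "\<Inter>F \<in> F" "A \<in> \<D>" "\<Inter>F \<in> \<D>" by auto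
      from tot[OF F(2,3)] show ?case
      proof
        assume "A \<subseteq> \<Inter>F"
        then have "\<Inter>(insert A F) = A" by auto
        then show ?thesis by simp
      next
        assume "\<Inter>F \<subseteq> A"
        then have "\<Inter>(insert A F) = \<Inter>F" by auto
        then show ?thesis using F(1) by simp
      qed
    qed simp
    have "C \<inter> \<Inter>\<D> \<noteq> {}"
    proof (rule compact_imp_fip[OF C])
      show "closed T" if "T \<in> \<D>" for T using that sub mem by blast
      show "C \<inter> \<Inter>F \<noteq> {}" if F: "finite F" "F \<subseteq> \<D>" for F
      proof (cases "F = {}")
        case True
        then show ?thesis using ne mem by fastforce
      next
        case False
        then have "\<Inter>F \<in> \<A>" using fin[OF F(1) _ F(2)] F(2) sub by blast
        then show ?thesis using mem[of "\<Inter>F"] by (simp add: Int_absorb1)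
      qed
    qed
    then have "\<Inter>\<D> \<in> \<A>" using \<C>(1) sub by (intro inter) (auto simp: \<D>_def)
    moreover have "\<Union>\<C> = - \<Inter>\<D>" by (auto simp: \<D>_def)
    ultimately show "\<Union>\<C> \<in> uminus ` \<A>" by blast
  qed (use ne in simp)
  then obtain M where "M \<in> \<A>" "\<forall>S\<in>\<A>. - M \<subseteq> - S \<longrightarrow> - S = - M" by auto
  then show ?thesis by (intro bexI[of _ M]) auto
qed

section \<open>Self-maps under pointwise convergence\<close>

lemma compact_fun_imp_closed:
  fixes S :: "('a \<Rightarrow> 'b::metric_space) set"
  assumes "compact S" shows "closed S"
proof -
  have "Hausdorff_space (euclidean :: ('a \<Rightarrow> 'b) topology)"
    using Hausdorff_space_product_topology[of "\<lambda>_ :: 'a. euclidean :: 'b topology" UNIV] Hausdorff_space_euclidean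
    by (auto simp: euclidean_product_topology)
  then show ?thesis using assms compactin_imp_closedin by fastforce
qed

lemma compact_PiE_UNIV:
  fixes S :: "'a \<Rightarrow> 'b::topological_space set"
  assumes "\<And>i. compact (S i)" shows "compact (PiE UNIV S)"
  using assms compactin_PiE[of "\<lambda>_. euclidean" UNIV S] by (simp add: euclidean_product_topology)

text \<open>Right composition merely reindexes coordinates, so it is continuous for arbitrary
  \<open>p\<close>. This is the one-sided continuity of the Ellis semigroup.\<close>

lemma continuous_on_comp_right: "continuous_on S (\<lambda>q :: 'b \<Rightarrow> 'c::topological_space. q \<circ> p)"
  unfolding comp_def by (intro continuous_on_coordinatewise_then_product) (rule continuous_on_subset[OF continuous_on_product_coordinates subset_UNIV])

text \<open>In a minimal closed subsemigroup \<open>S\<close> with element \<open>u\<close>, the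
  subsemigroup of all \<open>q \<circ> u\<close> is all of \<open>S\<close>. Hence some
  \<open>q\<close> satisfies \<open>q \<circ> u = u\<close>, and by minimality every element does,
  including \<open>u\<close>.\<close>

lemma ellis_numakura:
  fixes L :: "('a::metric_space \<Rightarrow> 'a) set"
  assumes L: "compact L" "L \<noteq> {}" and semi: "\<And>p q. p \<in> L \<Longrightarrow> q \<in> L \<Longrightarrow> p \<circ> q \<in> L"
  shows "\<exists>u\<in>L. u \<circ> u = u"
proof -
  define \<A> where "\<A> = {S. S \<subseteq> L \<and> closed S \<and> S \<noteq> {} \<and> (\<forall>p\<in>S. \<forall>q\<in>S. p \<circ> q \<in> S)}"
  have "\<exists>S\<in>\<A>. \<forall>R\<in>\<A>. R \<subseteq> S \<longrightarrow> R = S"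
  proof (rule compact_minimal_set[OF L(1)])
    have "L \<in> \<A>" using L semi compact_fun_imp_closed[OF L(1)] by (auto simp: \<A>_def)
    then show "\<A> \<noteq> {}" by blast
    fix \<D> assume "\<D> \<subseteq> \<A>" "\<D> \<noteq> {}" "\<Inter>\<D> \<noteq> {}"
    then show "\<Inter>\<D> \<in> \<A>" unfolding \<A>_def by (auto intro!: closed_Inter) blast+
  qed (auto simp: \<A>_def)
  then obtain S where S: "S \<subseteq> L" "closed S" "S \<noteq> {}" "\<And>p q. p \<in> S \<Longrightarrow> q \<in> S \<Longrightarrow> p \<circ> q \<in> S"
    and min: "\<And>R. R \<in> \<A> \<Longrightarrow> R \<subseteq> S \<Longrightarrow> R = S" by (auto simp: \<A>_def)
  obtain u where u: "u \<in> S" using S(3) by blast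
  have "compact S" using L(1) S(1,2) by (metis compact_Int_closed inf.absorb_iff2)
  define R where "R = (\<lambda>q. q \<circ> u) ` S"
  have "compact R" unfolding R_def using \<open>compact S\<close> continuous_on_comp_right by (intro compact_continuous_image)
  moreover have RS: "R \<subseteq> S" using S(4) u by (auto simp: R_def)
  moreover have "p \<circ> q \<in> R" if pq: "p \<in> R" "q \<in> R" for p q
  proof -
    obtain p' where "p' \<in> S" "p = p' \<circ> u" using pq(1) by (auto simp: R_def)
    moreover obtain q' where "q' \<in> S" "q = q' \<circ> u" using pq(2) by (auto simp: R_def)
    ultimately have "p \<circ> q = (p' \<circ> u \<circ> q') \<circ> u" "p' \<circ> u \<circ> q' \<in> S" using S(4) u by (auto simp: comp_assoc)
    then show ?thesis unfolding R_def by blast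
  qed
  ultimately have "R = S" using u S(1) compact_fun_imp_closed by (intro min) (auto simp: \<A>_def R_def)
  then obtain q where q: "q \<in> S" "q \<circ> u = u" using u unfolding R_def by (metis imageE)
  define Q where "Q = {q \<in> S. q \<circ> u = u}"
  have "closed ({u} :: ('a \<Rightarrow> 'a) set)" by (rule compact_fun_imp_closed) simp
  then have "closed Q"
    unfolding Q_def using continuous_closed_preimage[OF continuous_on_comp_right S(2), of "{u}" u]
    by (simp add: Int_def vimage_def)
  moreover have "p \<circ> q \<in> Q" if "p \<in> Q" "q \<in> Q" for p q
    using that S(4) by (auto simp: Q_def comp_assoc)
  ultimately have "Q = S" using q S(1) by (intro min) (auto simp: \<A>_def Q_def)
  then show ?thesis using u S(1) by (auto simp: Q_def)
qed

text \<open>\<open>u\<close> is an idempotent of a minimal left ideal in the Ellis semigroup of \<open>T\<close>; maps are extended by the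
  identity outside \<open>X\<close>.\<close>
lemma minimal_idempotent:
  assumes D: "dyn_sys X T"
  shows "\<exists>u. (\<forall>x\<in>X. u x \<in> X) \<and>
     (\<forall>x\<in>X. \<forall>e>0. \<exists>n. dist ((T ^^ n) x) ((T ^^ n) (u x)) < e) \<and>
     (\<forall>F e. finite F \<longrightarrow> F \<subseteq> X \<longrightarrow> e > 0 \<longrightarrow> (\<exists>L. \<forall>n. \<exists>r\<ge>n. r \<le> n + L \<and> (\<forall>x\<in>F. dist ((T ^^ r) (u x)) (u x) < e)))"
proof -
  have TX: "continuous_on X T" "\<And>x. x \<in> X \<Longrightarrow> T x \<in> X" "compact X" using D by (auto simp: dyn_sys_def)
  define \<Phi> where "\<Phi> = PiE UNIV (\<lambda>x. if x \<in> X then X else {x})"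
  have \<Phi>: "p \<in> \<Phi> \<longleftrightarrow> (\<forall>x\<in>X. p x \<in> X) \<and> (\<forall>x. x \<notin> X \<longrightarrow> p x = x)" for p
    by (force simp: \<Phi>_def PiE_iff)
  have c\<Phi>: "compact \<Phi>" unfolding \<Phi>_def using TX(3) by (intro compact_PiE_UNIV) auto
  define S where "S x = (if x \<in> X then T x else x)" for x
  have Spow: "(S ^^ n) x = (if x \<in> X then (T ^^ n) x else x)" for n x
    by (induction n) (auto simp: S_def dyn_sys_iter_in[OF D])
  have S\<Phi>: "(S ^^ n) \<circ> p \<in> \<Phi>" if "p \<in> \<Phi>" for p n
    using that dyn_sys_iter_in[OF D] by (auto simp: \<Phi> Spow)
  \<comment> \<open>\<open>S\<close> itself may jump at the boundary of \<open>X\<close>. On \<Phi>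
    each coordinate either stays in \<open>X\<close>, where \<open>S\<close> is \<open>T\<close>, or
    is constant.\<close>
  have contS: "continuous_on A (\<lambda>p. (S ^^ n) \<circ> p)" if "A \<subseteq> \<Phi>" for n A
    unfolding comp_def
  proof (rule continuous_on_coordinatewise_then_product)
    fix x
    have cx: "continuous_on A (\<lambda>p. p x)" by (rule continuous_on_subset[OF continuous_on_product_coordinates subset_UNIV])
    show "continuous_on A (\<lambda>p. (S ^^ n) (p x))"
    proof (cases "x \<in> X")
      case True
      have "continuous_on A (\<lambda>p. (T ^^ n) (p x))"
        by (rule continuous_on_compose2[OF dyn_sys_continuous_iter[OF D] cx]) (use that True \<Phi> in auto)
      moreover have "(S ^^ n) (p x) = (T ^^ n) (p x)" if "p \<in> A" for p
        using that \<open>A \<subseteq> \<Phi>\<close> True by (auto simp: Spow \<Phi>)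
      ultimately show ?thesis by (metis (no_types, lifting) continuous_on_cong)
    next
      case False
      have "(S ^^ n) (p x) = x" if "p \<in> A" for p
        using that \<open>A \<subseteq> \<Phi>\<close> False by (auto simp: Spow \<Phi>)
      then show ?thesis using continuous_on_cong[of A A "\<lambda>p. (S ^^ n) (p x)" "\<lambda>_. x"] by simp
    qed
  qed
  have closure_inv: "S \<circ> p \<in> closure Q" if Q: "Q \<subseteq> \<Phi>" "\<And>q. q \<in> Q \<Longrightarrow> S \<circ> q \<in> Q" and p: "p \<in> closure Q" for p Q
  proof -
    have "closure Q \<subseteq> \<Phi>" using Q(1) compact_fun_imp_closed[OF c\<Phi>] by (rule closure_minimal)
    then have "continuous_on (closure Q) (\<lambda>p. S \<circ> p)" using contS[of "closure Q" 1] by simp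
    moreover have "(\<lambda>p. S \<circ> p) ` Q \<subseteq> closure Q" using Q(2) closure_subset by fast
    ultimately have "(\<lambda>p. S \<circ> p) ` closure Q \<subseteq> closure Q" by (intro image_closure_subset) auto
    then show ?thesis using p by blast
  qed
  define E where "E = closure (range (\<lambda>n. S ^^ n))"
  have powPhi: "S ^^ n \<in> \<Phi>" for n by (auto simp: \<Phi> Spow dyn_sys_iter_in[OF D])
  have E\<Phi>: "E \<subseteq> \<Phi>" unfolding E_def using powPhi compact_fun_imp_closed[OF c\<Phi>] by (intro closure_minimal) auto
  have ES: "S \<circ> p \<in> E" if "p \<in> E" for p
    unfolding E_def
  proof (rule closure_inv)
    show "range (\<lambda>n. S ^^ n) \<subseteq> \<Phi>" using powPhi by blast
    show "S \<circ> q \<in> range (\<lambda>n. S ^^ n)" if q: "q \<in> range (\<lambda>n. S ^^ n)" for q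
    proof -
      obtain n where "q = S ^^ n" using q by blast
      then have "S \<circ> q = S ^^ Suc n" by simp
      then show ?thesis by blast
    qed
    show "p \<in> closure (range (\<lambda>n. S ^^ n))" using that by (simp add: E_def)
  qed
  \<comment> \<open>Closed sets invariant under left composition with \<open>S\<close> inside the
    Ellis semigroup \<open>E\<close>; a minimal one is a minimal left ideal.\<close>
  define \<A> where "\<A> = {L. L \<subseteq> E \<and> closed L \<and> L \<noteq> {} \<and> (\<forall>p\<in>L. S \<circ> p \<in> L)}"
  have "\<exists>L\<in>\<A>. \<forall>R\<in>\<A>. R \<subseteq> L \<longrightarrow> R = L"
  proof (rule compact_minimal_set[OF c\<Phi>])
    have "E \<in> \<A>" using ES by (auto simp: \<A>_def E_def)
    then show "\<A> \<noteq> {}" by blast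
    fix \<D> assume "\<D> \<subseteq> \<A>" "\<D> \<noteq> {}" "\<Inter>\<D> \<noteq> {}"
    then show "\<Inter>\<D> \<in> \<A>" unfolding \<A>_def by (auto intro!: closed_Inter) blast+
  qed (use E\<Phi> in \<open>auto simp: \<A>_def\<close>)
  then obtain L where L: "L \<subseteq> E" "closed L" "L \<noteq> {}" "\<And>p. p \<in> L \<Longrightarrow> S \<circ> p \<in> L"
    and min: "\<And>R. R \<in> \<A> \<Longrightarrow> R \<subseteq> L \<Longrightarrow> R = L" by (auto simp: \<A>_def)
  have L\<Phi>: "L \<subseteq> \<Phi>" using L(1) E\<Phi> by blast
  have cL: "compact L" using c\<Phi> L(2) L\<Phi> by (metis compact_Int_closed inf.absorb_iff2)
  have Lpow: "(S ^^ n) \<circ> p \<in> L" if "p \<in> L" for n p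
  proof (induction n)
    case (Suc n)
    have "(S ^^ Suc n) \<circ> p = S \<circ> ((S ^^ n) \<circ> p)" by (simp add: comp_assoc)
    then show ?case using L(4)[OF Suc] by (simp only:)
  qed (use that in simp)
  \<comment> \<open>Elements of \<open>L\<close> are limits of iterates of \<open>S\<close>, which
    map \<open>p\<close> into \<open>L\<close>; right composition with \<open>p\<close> preserves
    such limits.\<close>
  have "q \<circ> p \<in> L" if "q \<in> L" "p \<in> L" for q p
  proof -
    have "(\<lambda>q. q \<circ> p) ` closure (range (\<lambda>n. S ^^ n)) \<subseteq> L"
      using Lpow[OF that(2)] L(2) by (intro image_closure_subset continuous_on_comp_right) auto
    then show ?thesis using that(1) L(1) unfolding E_def by blast
  qed
  then obtain u where u: "u \<in> L" "u \<circ> u = u" using ellis_numakura[OF cL L(3)] by blast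
  have uX: "u x \<in> X" if "x \<in> X" for x using u(1) L\<Phi> \<Phi> that by blast
  have op: "open {p :: 'a \<Rightarrow> 'a. dist (p x) c < e}" for x c e
    by (intro open_Collect_less continuous_intros continuous_on_product_coordinates)
  \<comment> \<open>By idempotence \<open>u\<close> sends \<open>x\<close> and \<open>u x\<close> to
    the same point, and an iterate close to \<open>u\<close> at both brings them together.\<close>
  have prox: "\<exists>n. dist ((T ^^ n) x) ((T ^^ n) (u x)) < e" if "x \<in> X" "e > 0" for x e
  proof -
    let ?O = "{p. dist (p x) (u x) < e / 2} \<inter> {p. dist (p (u x)) (u x) < e / 2}"
    have "u (u x) = u x" using u(2) by (metis comp_apply)
    then have "u \<in> closure (range (\<lambda>n. S ^^ n)) \<inter> ?O" using u(1) L(1) \<open>e > 0\<close> unfolding E_def by auto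
    then have "?O \<inter> closure (range (\<lambda>n. S ^^ n)) \<noteq> {}" by blast
    then have "?O \<inter> range (\<lambda>n. S ^^ n) \<noteq> {}"
      using open_Int_closure_eq_empty[of ?O] op by blast
    then obtain n where "dist ((S ^^ n) x) (u x) < e / 2" "dist ((S ^^ n) (u x)) (u x) < e / 2" by auto
    then show ?thesis using that(1) uX[OF that(1)] unfolding Spow
      by (intro exI[of _ n]) (auto intro: dist_triangle_half_l)
  qed
  have rec: "\<exists>L. \<forall>n. \<exists>r\<ge>n. r \<le> n + L \<and> (\<forall>x\<in>F. dist ((T ^^ r) (u x)) (u x) < e)"
    if F: "finite F" "F \<subseteq> X" and "e > 0" for F e
  proof -
    let ?O = "\<Inter>x\<in>F. {p. dist (p x) (u x) < e}"
    have oO: "open ?O" using F(1) op by (intro open_INT) auto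
    \<comment> \<open>Minimality makes the orbit of \<open>q\<close> dense in \<open>L\<close>, so
      it enters the neighbourhood \<open>?O\<close> of \<open>u\<close>. Compactness of
      \<open>L\<close> then bounds the waiting time, and a neighbourhood given by finitely many
      coordinates yields joint recurrence.\<close>
    have hit: "\<exists>n. q \<in> {p \<in> L. (S ^^ n) \<circ> p \<in> ?O}" if q: "q \<in> L" for q
    proof -
      let ?R = "closure (range (\<lambda>n. (S ^^ n) \<circ> q))"
      have RL: "?R \<subseteq> L" using Lpow[OF q] L(2) by (intro closure_minimal) auto
      have "S \<circ> p \<in> ?R" if "p \<in> ?R" for p
      proof (rule closure_inv[OF _ _ that])
        show "range (\<lambda>n. (S ^^ n) \<circ> q) \<subseteq> \<Phi>" using S\<Phi> q L\<Phi> by blast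
        show "S \<circ> r \<in> range (\<lambda>n. (S ^^ n) \<circ> q)" if r: "r \<in> range (\<lambda>n. (S ^^ n) \<circ> q)" for r
        proof -
          obtain n where "r = (S ^^ n) \<circ> q" using r by blast
          then have "S \<circ> r = (S ^^ Suc n) \<circ> q" by (simp add: comp_assoc)
          then show ?thesis by blast
        qed
      qed
      then have "?R \<in> \<A>" using RL L(1) by (auto simp: \<A>_def)
      then have "?R = L" using RL by (rule min)
      then have "u \<in> ?R" using u(1) by simp
      moreover have "u \<in> ?O" using \<open>e > 0\<close> by simp
      ultimately have "?O \<inter> range (\<lambda>n. (S ^^ n) \<circ> q) \<noteq> {}"
        using open_Int_closure_eq_empty[OF oO] by blast
      then obtain n where "(S ^^ n) \<circ> q \<in> ?O" by blast
      then show ?thesis using q by blast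
    qed
    have "openin (top_of_set L) {p \<in> L. (S ^^ n) \<circ> p \<in> ?O}" for n
      using continuous_openin_preimage_gen[OF contS[OF L\<Phi>] oO] by (simp add: vimage_def Int_def)
    from compact_openin_increasing_cover[OF cL this hit]
    obtain N where N: "\<And>q. q \<in> L \<Longrightarrow> \<exists>n\<le>N. q \<in> {p \<in> L. (S ^^ n) \<circ> p \<in> ?O}" by blast
    show ?thesis
    proof (rule exI[of _ N], rule allI)
      fix n
      obtain m where m: "m \<le> N" "(S ^^ m) \<circ> ((S ^^ n) \<circ> u) \<in> ?O" using N[OF Lpow[OF u(1)]] by blast
      have "dist ((T ^^ (m + n)) (u x)) (u x) < e" if "x \<in> F" for x
      proof -
        have "dist ((S ^^ m) ((S ^^ n) (u x))) (u x) < e" using m(2) that by auto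
        moreover have "u x \<in> X" using uX that F(2) by blast
        ultimately show ?thesis using dyn_sys_iter_in[OF D] by (simp add: Spow funpow_add)
      qed
      then show "\<exists>r\<ge>n. r \<le> n + N \<and> (\<forall>x\<in>F. dist ((T ^^ r) (u x)) (u x) < e)"
        using m(1) by (intro exI[of _ "m + n"]) auto
    qed
  qed
  show ?thesis
    by (rule exI[of _ u], intro conjI ballI allI impI; (rule uX prox rec; assumption))
qed

section \<open>Mean equicontinuity\<close>

text \<open>This expresses equicontinuity of the quotient by the proximal relation through distances
  to that relation. Failure yields pairs that start near the diagonal and escape; after replacing
  them by recurrent representatives, they produce separated families.\<close>

lemma proximal_factor_equicontinuous:
  assumes D: "dyn_sys X T" and null: "null_system X T" and cl: "closed (proximal X T)" and "\<rho> > 0"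
  shows "\<exists>d>0. \<forall>x\<in>X. \<forall>y\<in>X. dist x y < d \<longrightarrow>
    (\<forall>i. infdist ((map_prod T T ^^ i) (x, y)) (proximal X T) < \<rho>)"
proof (rule ccontr)
  assume no: "\<not> ?thesis"
  let ?S = "map_prod T T" and ?P = "proximal X T"
  let ?f = "\<lambda>w. infdist w (proximal X T)"
  note DD = dyn_sys_map_prod[OF D]
  have f: "continuous_on A ?f" for A by (intro continuous_intros)
  have "\<forall>k. \<exists>z i. z \<in> X \<times> X \<and> dist (fst z) (snd z) < 1 / real (Suc k) \<and> \<rho> \<le> ?f ((?S ^^ i) z)"
  proof
    fix k
    have "1 / real (Suc k) > 0" by simp
    then obtain x y i where "x \<in> X" "y \<in> X" "dist x y < 1 / real (Suc k)" "\<not> ?f ((?S ^^ i) (x, y)) < \<rho>"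
      using no by blast
    then show "\<exists>z i. z \<in> X \<times> X \<and> dist (fst z) (snd z) < 1 / real (Suc k) \<and> \<rho> \<le> ?f ((?S ^^ i) z)"
      by (intro exI[of _ "(x, y)"] exI[of _ i]) auto
  qed
  then obtain z i where z: "\<And>k. z k \<in> X \<times> X" "\<And>k. dist (fst (z k)) (snd (z k)) < 1 / real (Suc k)"
    and far: "\<And>k. \<rho> \<le> ?f ((?S ^^ i k) (z k))" by metis
  obtain u where u: "\<forall>x\<in>X. u x \<in> X" "\<forall>x\<in>X. \<forall>e>0. \<exists>n. dist ((T ^^ n) x) ((T ^^ n) (u x)) < e"
      "\<forall>F e. finite F \<longrightarrow> F \<subseteq> X \<longrightarrow> e > 0 \<longrightarrow> (\<exists>L. \<forall>n. \<exists>r\<ge>n. r \<le> n + L \<and> (\<forall>x\<in>F. dist ((T ^^ r) (u x)) (u x) < e))"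
    using minimal_idempotent[OF D] by (elim exE conjE) (rule that)
  have uX: "u x \<in> X" if "x \<in> X" for x using u(1) that by blast
  have uP: "(x, u x) \<in> ?P" if "x \<in> X" for x
    using proximalI[OF D that uX[OF that]] u(2) that by blast
  \<comment> \<open>Each coordinate keeps its proximal class, while any finitely many of these pairs
    become jointly recurrent.\<close>
  define W where "W k = map_prod u u (z k)" for k
  have W: "W k \<in> X \<times> X" for k using z(1)[of k] uX by (auto simp: W_def)
  have pair: "(fst (z k), fst (W k)) \<in> ?P" "(snd (z k), snd (W k)) \<in> ?P" for k
    using z(1)[of k] uP by (auto simp: W_def)
  have S_fst: "fst ((?S ^^ n) w) = (T ^^ n) (fst w)" and S_snd: "snd ((?S ^^ n) w) = (T ^^ n) (snd w)" for n w
    by (cases w; simp add: funpow_map_prod)+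
  \<comment> \<open>Bundling the four sequences lets one subsequence make all of them
    converge.\<close>
  define q where "q k = ((z k, W k), ((?S ^^ i k) (z k), (?S ^^ i k) (W k)))" for k
  have "compact (((X \<times> X) \<times> (X \<times> X)) \<times> ((X \<times> X) \<times> (X \<times> X)))"
    using D by (simp add: dyn_sys_def compact_Times)
  moreover have "q k \<in> ((X \<times> X) \<times> (X \<times> X)) \<times> ((X \<times> X) \<times> (X \<times> X))" for k
    using z(1) W dyn_sys_iter_in[OF DD] by (simp only: q_def mem_Times_iff fst_conv snd_conv)
  ultimately obtain l r where l: "l \<in> ((X \<times> X) \<times> (X \<times> X)) \<times> ((X \<times> X) \<times> (X \<times> X))"
    and r: "strict_mono r" "(q \<circ> r) \<longlonglongrightarrow> l" unfolding compact_def by metis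
  obtain z1 W1 z2 W2 where l_eq: "l = ((z1, W1), (z2, W2))" by (metis prod.collapse)
  have lX: "z1 \<in> X \<times> X" "W1 \<in> X \<times> X" "z2 \<in> X \<times> X" "W2 \<in> X \<times> X" using l by (auto simp: l_eq)
  have lim: "(\<lambda>k. z (r k)) \<longlonglongrightarrow> z1" "(\<lambda>k. W (r k)) \<longlonglongrightarrow> W1"
    "(\<lambda>k. (?S ^^ i (r k)) (z (r k))) \<longlonglongrightarrow> z2" "(\<lambda>k. (?S ^^ i (r k)) (W (r k))) \<longlonglongrightarrow> W2"
    using tendsto_fst[OF tendsto_fst[OF r(2)]] tendsto_snd[OF tendsto_fst[OF r(2)]]
      tendsto_fst[OF tendsto_snd[OF r(2)]] tendsto_snd[OF tendsto_snd[OF r(2)]]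
    by (simp_all add: l_eq q_def comp_def)
  have limP: "(a, b) \<in> ?P" if "\<And>k. (A k, B k) \<in> ?P" "A \<longlonglongrightarrow> a" "B \<longlonglongrightarrow> b" for A B a b
    using closed_sequentially[OF cl, of "\<lambda>k. (A k, B k)" "(a, b)"] that tendsto_Pair by blast
  have p1: "(fst z1, fst W1) \<in> ?P" "(snd z1, snd W1) \<in> ?P"
    by (rule limP[OF pair(1) tendsto_fst[OF lim(1)] tendsto_fst[OF lim(2)]],
        rule limP[OF pair(2) tendsto_snd[OF lim(1)] tendsto_snd[OF lim(2)]])
  have p2: "(fst z2, fst W2) \<in> ?P" "(snd z2, snd W2) \<in> ?P"
    by (rule limP[OF _ tendsto_fst[OF lim(3)] tendsto_fst[OF lim(4)]], simp add: S_fst proximal_iter[OF D pair(1)],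
        rule limP[OF _ tendsto_snd[OF lim(3)] tendsto_snd[OF lim(4)]], simp add: S_snd proximal_iter[OF D pair(2)])
  have "fst z1 = snd z1"
  proof -
    have "(\<lambda>k. dist (fst (z (r k))) (snd (z (r k)))) \<longlonglongrightarrow> dist (fst z1) (snd z1)"
      using lim(1) by (intro tendsto_intros)
    moreover have "(\<lambda>k. dist (fst (z (r k))) (snd (z (r k)))) \<longlonglongrightarrow> 0"
    proof (rule real_tendsto_sandwich[OF _ _ tendsto_const])
      show "(\<lambda>k. 1 / real (Suc (r k))) \<longlonglongrightarrow> 0"
        using LIMSEQ_subseq_LIMSEQ[OF LIMSEQ_Suc[OF lim_1_over_n] r(1)] by (simp add: comp_def)
      show "\<forall>\<^sub>F k in sequentially. dist (fst (z (r k))) (snd (z (r k))) \<le> 1 / real (Suc (r k))"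
        using z(2) by (intro always_eventually allI less_imp_le)
    qed simp
    ultimately show ?thesis using LIMSEQ_unique by fastforce
  qed
  \<comment> \<open>The limit \<open>z1\<close> is on the diagonal and both coordinates of
    \<open>W1\<close> are proximal to it; transitivity closes the chain.\<close>
  then have "(fst W1, snd W1) \<in> ?P"
    using p1 proximal_trans[OF D cl] proximal_sym by metis
  then have W1: "W1 \<in> ?P" by simp
  have "\<rho> \<le> ?f z2"
    by (rule LIMSEQ_le_const[OF tendsto_infdist[OF lim(3)]]) (use far in auto)
  then have "z2 \<notin> ?P" using \<open>\<rho> > 0\<close> by (intro notI) simp
  \<comment> \<open>The escape is inherited: a proximal \<open>W2\<close> would make
    \<open>z2\<close> proximal by transitivity, although \<open>z2\<close> has distance at least
    \<rho> from the relation.\<close>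
  have "W2 \<notin> ?P"
  proof
    assume "W2 \<in> ?P"
    then have "(fst W2, snd W2) \<in> ?P" by simp
    then have "(fst z2, snd z2) \<in> ?P" using p2 proximal_trans[OF D cl] proximal_sym by metis
    with \<open>z2 \<notin> ?P\<close> show False by simp
  qed
  then obtain c where c: "c > 0" "\<And>j. c \<le> ?f ((?S ^^ j) W2)"
    using not_proximal_orbit_away[OF D cl lX(4)] by blast
  have lim_iter: "(\<lambda>k. ?f ((?S ^^ t) (A k))) \<longlonglongrightarrow> ?f ((?S ^^ t) a)"
    if "A \<longlonglongrightarrow> a" "\<And>k. A k \<in> X \<times> X" "a \<in> X \<times> X" for A a t
    by (intro tendsto_infdist continuous_on_tendsto_compose[OF dyn_sys_continuous_iter[OF DD] that(1)])
      (use that in auto)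
  \<comment> \<open>The orbit of \<open>W2\<close> stays at distance at least \<open>c\<close>,
    which strictly exceeds \<open>3 * (c / 4)\<close>, so the far condition survives for pairs near
    the limit.\<close>
  have "exp_separated (X \<times> X) ?S ?f (c / 4) n" for n
  proof (rule escaping_recurrent_exp_separated[OF DD f, where W = "\<lambda>k. W (r k)" and m = "\<lambda>k. i (r k)"])
    show "W (r k) \<in> X \<times> X" for k by (rule W)
    show "c / 4 > 0" using c by simp
    show "\<forall>\<^sub>F k in sequentially. ?f ((?S ^^ t) (W (r k))) \<le> c / 4 / 2" for t
    proof -
      have "?f ((?S ^^ t) W1) = 0" using proximal_iter_prod[OF D W1] by simp
      then have "?f ((?S ^^ t) W1) < c / 4 / 2" using c(1) by simp
      from order_tendstoD(2)[OF lim_iter[OF lim(2) W lX(2)] this] show ?thesis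
        by eventually_elim simp
    qed
    show "\<forall>\<^sub>F k in sequentially. \<forall>j\<le>J. 3 * (c / 4) \<le> ?f ((?S ^^ (i (r k) + j)) (W (r k)))" for J
    proof -
      have "\<forall>\<^sub>F k in sequentially. 3 * (c / 4) \<le> ?f ((?S ^^ (i (r k) + j)) (W (r k)))" for j
      proof -
        have "3 * (c / 4) < ?f ((?S ^^ j) W2)" using c(2)[of j] c(1) by linarith
        from order_tendstoD(1)[OF lim_iter[OF lim(4) dyn_sys_iter_in[OF DD W] lX(4)] this] show ?thesis
        proof eventually_elim
          case (elim k)
          have "(?S ^^ (i (r k) + j)) (W (r k)) = (?S ^^ j) ((?S ^^ i (r k)) (W (r k)))"
            by (simp only: funpow_add add.commute[of _ j] comp_apply)
          then show ?case using elim by simp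
        qed
      qed
      then have "\<forall>\<^sub>F k in sequentially. \<forall>j\<in>{..J}. 3 * (c / 4) \<le> ?f ((?S ^^ (i (r k) + j)) (W (r k)))"
        by (intro eventually_ball_finite) auto
      then show ?thesis by eventually_elim auto
    qed
    show "\<exists>L. \<forall>n. \<exists>m\<ge>n. m \<le> n + L \<and> (\<forall>k\<in>F. dist ((?S ^^ m) (W (r k))) (W (r k)) < d)"
      if F: "finite F" "d > 0" for F d
    proof -
      \<comment> \<open>Returning simultaneously at all coordinates, each within
        \<open>d / 2\<close>, makes all the chosen pairs return together.\<close>
      define G where "G = (\<lambda>k. fst (z (r k))) ` F \<union> (\<lambda>k. snd (z (r k))) ` F"
      have "finite G" "G \<subseteq> X" using F(1) z(1) by (auto simp: G_def mem_Times_iff)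
      then obtain L where L: "\<And>n. \<exists>m\<ge>n. m \<le> n + L \<and> (\<forall>x\<in>G. dist ((T ^^ m) (u x)) (u x) < d / 2)"
        using u(3)[rule_format, of G "d / 2"] F(2) by auto
      have "\<exists>m\<ge>n. m \<le> n + L \<and> (\<forall>k\<in>F. dist ((?S ^^ m) (W (r k))) (W (r k)) < d)" for n
      proof -
        obtain m where m: "m \<ge> n" "m \<le> n + L" "\<And>x. x \<in> G \<Longrightarrow> dist ((T ^^ m) (u x)) (u x) < d / 2"
          using L[of n] by blast
        have "dist ((?S ^^ m) (W (r k))) (W (r k)) < d" if k: "k \<in> F" for k
        proof -
          obtain x y where xy: "z (r k) = (x, y)" by (cases "z (r k)")
          have "x \<in> G" "y \<in> G" using k xy by (force simp: G_def)+
          have "dist ((?S ^^ m) (W (r k))) (W (r k)) \<le> dist ((T ^^ m) (u x)) (u x) + dist ((T ^^ m) (u y)) (u y)"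
            unfolding W_def xy map_prod_simp funpow_map_prod dist_Pair_Pair by (rule sqrt_sum_squares_le_sum) auto
          then show ?thesis using m(3)[OF \<open>x \<in> G\<close>] m(3)[OF \<open>y \<in> G\<close>] by simp
        qed
        then show ?thesis using m by blast
      qed
      then show ?thesis by blast
    qed
  qed
  then show False using null_not_exp_separated[OF D null f, of "c / 4"] c(1) by auto
qed

text \<open>Peeling off final blocks of length \<open>n\<close> leaves fewer than \<open>n\<close>
  terms, whose total is at most \<open>n * B\<close> and vanishes in the average.\<close>

lemma limsup_avg_le:
  fixes a :: "nat \<Rightarrow> real"
  assumes a: "\<And>i. 0 \<le> a i" "\<And>i. a i \<le> B" and n: "n \<ge> 1" and block: "\<And>j. (\<Sum>i<n. a (j + i)) \<le> e * real n" and "e \<ge> 0"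
  shows "limsup (\<lambda>N. ereal ((\<Sum>i<N. a i) / real N)) \<le> ereal e"
proof -
  have le: "(\<Sum>i<N. a i) \<le> e * real N + real n * B" for N
  proof (induction N rule: less_induct)
    case (less N)
    have "B \<ge> 0" using a[of 0] by simp
    show ?case
    proof (cases "N < n")
      case True
      have "(\<Sum>i<N. a i) \<le> (\<Sum>i<N. B)" by (intro sum_mono a(2))
      also have "\<dots> \<le> real n * B" using True \<open>B \<ge> 0\<close> by (simp add: mult_right_mono)
      also have "\<dots> \<le> e * real N + real n * B" using \<open>e \<ge> 0\<close> by simp
      finally show ?thesis .
    next
      case False
      then obtain M where M: "N = M + n" by (metis add.commute le_Suc_ex not_less)
      have "(\<Sum>i<M + k. a i) = (\<Sum>i<M. a i) + (\<Sum>i<k. a (M + i))" for k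
        by (induction k) (auto simp: add.assoc)
      then have "(\<Sum>i<N. a i) = (\<Sum>i<M. a i) + (\<Sum>i<n. a (M + i))" by (simp add: M)
      also have "\<dots> \<le> (e * real M + real n * B) + e * real n"
        using less.IH[of M] n M block[of M] by (intro add_mono) auto
      finally show ?thesis by (simp add: M algebra_simps)
    qed
  qed
  have "limsup (\<lambda>N. ereal ((\<Sum>i<N. a i) / real N)) \<le> limsup (\<lambda>N. ereal (e + real n * B / real N))"
  proof (rule Limsup_mono)
    show "\<forall>\<^sub>F N in sequentially. ereal ((\<Sum>i<N. a i) / real N) \<le> ereal (e + real n * B / real N)"
      using eventually_gt_at_top[of 0]
    proof eventually_elim
      case (elim N)
      then show ?case using le[of N] by (simp add: field_simps)
    qed
  qed
  also have "(\<lambda>N. e + real n * B / real N) \<longlonglongrightarrow> e + 0"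
    by (intro tendsto_add tendsto_const real_tendsto_divide_at_top[OF tendsto_const filterlim_real_sequentially])
  then have "limsup (\<lambda>N. ereal (e + real n * B / real N)) = ereal e"
    by (intro lim_imp_Limsup) auto
  finally show ?thesis .
qed

text \<open>Nearby points stay close to the proximal relation at all times. Over each block of
  length \<open>n\<close> their pair therefore shadows a proximal pair, whose average is at most
  \<open>e / 4\<close>, with error \<open>e / 4\<close>; all block averages are at most
  \<open>e / 2\<close>.\<close>

lemma closed_proximal_imp_mean_equicontinuous:
  assumes D: "dyn_sys X T" and null: "null_system X T" and cl: "closed (proximal X T)"
  shows "mean_equicontinuous X T"
  unfolding mean_equicontinuous_def
proof (intro allI impI)
  fix e :: real assume "e > 0"
  let ?S = "map_prod T T" and ?P = "proximal X T" and ?f = "\<lambda>w. dist (fst w) (snd w :: 'a)"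
  note DD = dyn_sys_map_prod[OF D]
  have f: "continuous_on (X \<times> X) ?f" by (intro continuous_intros)
  have e4: "e / 4 > 0" using \<open>e > 0\<close> by simp
  obtain n where n: "n \<ge> 1" "\<And>x y. (x, y) \<in> ?P \<Longrightarrow> (\<Sum>i<n. dist ((T ^^ i) x) ((T ^^ i) y)) \<le> e / 4 * real n"
    using proximal_mean_small[OF D null cl e4] by auto
  obtain \<rho> where \<rho>: "\<rho> > 0" "\<And>v w i. v \<in> X \<times> X \<Longrightarrow> w \<in> X \<times> X \<Longrightarrow> dist v w < \<rho> \<Longrightarrow> i \<le> n \<Longrightarrow>
      dist (?f ((?S ^^ i) v)) (?f ((?S ^^ i) w)) < e / 4"
    using dyn_sys_equicontinuous_upto[OF DD f e4, of n] by blast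
  obtain d where d: "d > 0" "\<And>x y i. x \<in> X \<Longrightarrow> y \<in> X \<Longrightarrow> dist x y < d \<Longrightarrow> infdist ((?S ^^ i) (x, y)) ?P < \<rho>"
    using proximal_factor_equicontinuous[OF D null cl \<rho>(1)] by blast
  have "bounded X" using D by (simp add: dyn_sys_def compact_imp_bounded)
  then obtain B where B: "\<And>x y. x \<in> X \<Longrightarrow> y \<in> X \<Longrightarrow> dist x y \<le> B"
    unfolding bounded_two_points by blast
  show "\<exists>\<delta>>0. \<forall>x\<in>X. \<forall>y\<in>X. dist x y < \<delta> \<longrightarrow>
        limsup (\<lambda>n. ereal ((\<Sum>i<n. dist ((T ^^ i) x) ((T ^^ i) y)) / real n)) < ereal e"
  proof (intro exI[of _ d] conjI d(1) ballI impI)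
    fix x y assume xy: "x \<in> X" "y \<in> X" "dist x y < d"
    have ne: "?P \<noteq> {}" using proximal_refl[OF xy(1)] by auto
    have "limsup (\<lambda>n. ereal ((\<Sum>i<n. dist ((T ^^ i) x) ((T ^^ i) y)) / real n)) \<le> ereal (e / 2)"
    proof (rule limsup_avg_le[where B = B and n = n])
      fix j
      have v: "(?S ^^ j) (x, y) \<in> X \<times> X" using xy by (intro dyn_sys_iter_in[OF DD]) auto
      have "\<exists>w\<in>?P. dist ((?S ^^ j) (x, y)) w < \<rho>"
        using d(2)[OF xy, of j] unfolding infdist_notempty[OF ne]
        by (subst (asm) cINF_less_iff) (auto intro: bdd_belowI[of _ 0] simp: ne)
      then obtain a b where w: "(a, b) \<in> ?P" "dist ((?S ^^ j) (x, y)) (a, b) < \<rho>" by auto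
      have "(\<Sum>i<n. dist ((T ^^ (j + i)) x) ((T ^^ (j + i)) y)) \<le> (\<Sum>i<n. dist ((T ^^ i) a) ((T ^^ i) b) + e / 4)"
      proof (rule sum_mono)
        fix i assume "i \<in> {..<n}"
        then have "dist (?f ((?S ^^ i) ((?S ^^ j) (x, y)))) (?f ((?S ^^ i) (a, b))) < e / 4"
          using \<rho>(2)[OF v _ w(2), of i] w(1) proximal_subset by auto
        then have "\<bar>dist ((T ^^ (j + i)) x) ((T ^^ (j + i)) y) - dist ((T ^^ i) a) ((T ^^ i) b)\<bar> < e / 4"
          by (simp add: funpow_map_prod dist_real_def funpow_add add.commute[of j])
        then show "dist ((T ^^ (j + i)) x) ((T ^^ (j + i)) y) \<le> dist ((T ^^ i) a) ((T ^^ i) b) + e / 4"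
          by linarith
      qed
      also have "\<dots> \<le> e / 4 * real n + real n * (e / 4)"
        using n(2)[OF w(1)] by (simp add: sum.distrib)
      finally show "(\<Sum>i<n. dist ((T ^^ (j + i)) x) ((T ^^ (j + i)) y)) \<le> e / 2 * real n" by simp
    qed (use xy \<open>e > 0\<close> B n dyn_sys_iter_in[OF D] in auto)
    also have "\<dots> < ereal e" using \<open>e > 0\<close> by simp
    finally show "limsup (\<lambda>n. ereal ((\<Sum>i<n. dist ((T ^^ i) x) ((T ^^ i) y)) / real n)) < ereal e" .
  qed
qed

section \<open>The regionally proximal relation and the equivalence\<close>

lemma proximal_subset_regionally_proximal: "proximal X T \<subseteq> regionally_proximal X T"
proof
  fix w assume "w \<in> proximal X T"
  then obtain x y where w: "w = (x, y)" "(x, y) \<in> proximal X T" by (cases w) auto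
  have "\<exists>x'\<in>X. \<exists>y'\<in>X. \<exists>n::nat. n \<ge> 1 \<and> dist x x' < e \<and> dist y y' < e \<and> dist ((T ^^ n) x') ((T ^^ n) y') < e"
    if "e > 0" for e
    using w(2) that unfolding proximal_iff by (intro bexI[of _ x] bexI[of _ y]) auto
  then show "w \<in> regionally_proximal X T" using w by (auto simp: regionally_proximal_def proximal_iff)
qed

lemma regionally_proximal_iff:
  "(x, y) \<in> regionally_proximal X T \<longleftrightarrow> x \<in> X \<and> y \<in> X \<and> (\<forall>e>0. \<exists>x'\<in>X. \<exists>y'\<in>X. \<exists>n::nat. n \<ge> 1 \<and>
     dist x x' < e \<and> dist y y' < e \<and> dist ((T ^^ n) x') ((T ^^ n) y') < e)"
  by (simp add: regionally_proximal_def)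

text \<open>Witnesses at precision \<open>e / 2\<close> for a pair within \<open>e / 2\<close> serve
  the limit at precision \<open>e\<close>. This yields closedness of the proximal relation once the
  two relations agree.\<close>

lemma regionally_proximal_closed:
  assumes D: "dyn_sys X T"
  shows "closed (regionally_proximal X T)"
  unfolding closed_sequential_limits
proof (intro allI impI, elim conjE)
  fix z l assume z: "\<forall>n. z n \<in> regionally_proximal X T" and lim: "z \<longlonglongrightarrow> l"
  obtain x y where l: "l = (x, y)" by (cases l)
  have zX: "z n \<in> X \<times> X" for n using z[rule_format, of n] by (cases "z n") (simp add: regionally_proximal_def)
  have "closed (X \<times> X)" using dyn_sys_closed[OF D] by (simp add: closed_Times)
  then have lX: "l \<in> X \<times> X" using zX lim by (meson closed_sequentially)
  have "\<exists>x'\<in>X. \<exists>y'\<in>X. \<exists>n::nat. n \<ge> 1 \<and> dist x x' < e \<and> dist y y' < e \<and> dist ((T ^^ n) x') ((T ^^ n) y') < e"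
    if "e > 0" for e
  proof -
    have "e / 2 > 0" using \<open>e > 0\<close> by simp
    then obtain k where "dist (z k) l < e / 2" using lim unfolding lim_sequentially by blast
    then have k: "dist (fst (z k)) x < e / 2" "dist (snd (z k)) y < e / 2"
      using dist_fst_le[of "z k" l] dist_snd_le[of "z k" l] by (auto simp: l)
    have "\<exists>x'\<in>X. \<exists>y'\<in>X. \<exists>n::nat. n \<ge> 1 \<and> dist (fst (z k)) x' < e / 2 \<and> dist (snd (z k)) y' < e / 2
        \<and> dist ((T ^^ n) x') ((T ^^ n) y') < e / 2"
    proof -
      have "(fst (z k), snd (z k)) \<in> regionally_proximal X T" using z by simp
      then show ?thesis using \<open>e / 2 > 0\<close> unfolding regionally_proximal_iff by (elim conjE) (rule mp, erule spec)
    qed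
    then obtain x' y' n where xy: "x' \<in> X" "y' \<in> X" "n \<ge> (1::nat)" "dist (fst (z k)) x' < e / 2" "dist (snd (z k)) y' < e / 2"
      "dist ((T ^^ n) x') ((T ^^ n) y') < e / 2"
      by (elim bexE exE conjE) (rule that)
    have "dist x x' < e" using k(1) xy(4) by (metis dist_commute dist_triangle_half_l)
    moreover have "dist y y' < e" using k(2) xy(5) by (metis dist_commute dist_triangle_half_l)
    ultimately show ?thesis using xy \<open>e > 0\<close> by (intro bexI[of _ x'] bexI[of _ y'] exI[of _ n]) auto
  qed
  then show "l \<in> regionally_proximal X T" using lX by (auto simp: regionally_proximal_def l)
qed

text \<open>A pair that is not proximal stays apart by some \<open>e\<close>. Comparing through
  \<open>x'\<close> and \<open>y'\<close> from time \<open>n\<close> on bounds this distance by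
  three terms, each of average at most \<open>e / 4\<close>, which is impossible over a long
  window.\<close>

lemma mean_equicontinuous_imp_proximal_eq:
  assumes D: "dyn_sys X T" and me: "mean_equicontinuous X T"
  shows "proximal X T = regionally_proximal X T"
proof (intro equalityI proximal_subset_regionally_proximal subsetI)
  fix w assume "w \<in> regionally_proximal X T"
  then obtain x y where w: "w = (x, y)" "x \<in> X" "y \<in> X" and
    rp: "\<And>e. e > 0 \<Longrightarrow> \<exists>x'\<in>X. \<exists>y'\<in>X. \<exists>n::nat. n \<ge> 1 \<and> dist x x' < e \<and> dist y y' < e \<and> dist ((T ^^ n) x') ((T ^^ n) y') < e"
    by (auto simp: regionally_proximal_def)
  have "(x, y) \<in> proximal X T"
  proof (rule ccontr)
    assume "(x, y) \<notin> proximal X T"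
    then obtain e where e: "e > 0" "\<And>n. e \<le> dist ((T ^^ n) x) ((T ^^ n) y)"
      using proximalI[OF D w(2,3)] by (meson not_le)
    let ?A = "\<lambda>a b N. \<Sum>i<N. dist ((T ^^ i) a) ((T ^^ i) b)"
    have e4: "e / 4 > 0" using e(1) by simp
    obtain d where d: "d > 0" "\<And>a b. a \<in> X \<Longrightarrow> b \<in> X \<Longrightarrow> dist a b < d \<Longrightarrow> limsup (\<lambda>N. ereal (?A a b N / real N)) < ereal (e / 4)"
      using me e4 unfolding mean_equicontinuous_def by blast
    have ev: "\<forall>\<^sub>F N in sequentially. ?A a b N \<le> e / 4 * real N" if "a \<in> X" "b \<in> X" "dist a b < d" for a b
      using Limsup_lessD[OF d(2)[OF that]] eventually_gt_at_top[of 0]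
      by eventually_elim (simp add: field_simps)
    obtain x' y' n where xy: "x' \<in> X" "y' \<in> X" "dist x x' < d" "dist y y' < d" "dist ((T ^^ n) x') ((T ^^ n) y') < d"
      using rp[OF d(1)] by blast
    \<comment> \<open>The windows for \<open>x\<close> and \<open>y\<close> are longer by
      \<open>n\<close>, so the estimate ends in \<open>N0 \<le> 2 * n\<close>; the last conjunct
      excludes this.\<close>
    have "\<forall>\<^sub>F N in sequentially. ?A x x' N \<le> e / 4 * real N \<and> ?A y y' N \<le> e / 4 * real N \<and>
        ?A ((T ^^ n) x') ((T ^^ n) y') N \<le> e / 4 * real N \<and> N > 3 * n"
      using w xy dyn_sys_iter_in[OF D] by (intro eventually_conj ev eventually_gt_at_top) auto
    then obtain N0 where N0: "\<And>N. N \<ge> N0 \<Longrightarrow> ?A x x' N \<le> e / 4 * real N \<and> ?A y y' N \<le> e / 4 * real N \<and>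
        ?A ((T ^^ n) x') ((T ^^ n) y') N \<le> e / 4 * real N \<and> N > 3 * n"
      unfolding eventually_sequentially by blast
    have shift: "(\<Sum>i<N0. dist ((T ^^ (i + n)) a) ((T ^^ (i + n)) b)) \<le> ?A a b (N0 + n)" for a b
    proof -
      have "(\<Sum>i<N0. dist ((T ^^ (i + n)) a) ((T ^^ (i + n)) b)) = (\<Sum>i\<in>(\<lambda>i. i + n) ` {..<N0}. dist ((T ^^ i) a) ((T ^^ i) b))"
        by (subst sum.reindex) auto
      also have "\<dots> \<le> ?A a b (N0 + n)" by (intro sum_mono2) auto
      finally show ?thesis .
    qed
    have "e * real N0 = (\<Sum>i<N0. e)" by simp
    also have "\<dots> \<le> (\<Sum>i<N0. dist ((T ^^ (i + n)) x) ((T ^^ (i + n)) x') + dist ((T ^^ (i + n)) y) ((T ^^ (i + n)) y')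
        + dist ((T ^^ i) ((T ^^ n) x')) ((T ^^ i) ((T ^^ n) y')))"
    proof (rule sum_mono)
      fix i
      have "dist ((T ^^ (i + n)) x) ((T ^^ (i + n)) y) \<le> dist ((T ^^ (i + n)) x) ((T ^^ (i + n)) x')
          + dist ((T ^^ (i + n)) x') ((T ^^ (i + n)) y') + dist ((T ^^ (i + n)) y') ((T ^^ (i + n)) y)"
        by (meson add_right_mono dist_triangle order_trans)
      then show "e \<le> dist ((T ^^ (i + n)) x) ((T ^^ (i + n)) x') + dist ((T ^^ (i + n)) y) ((T ^^ (i + n)) y')
        + dist ((T ^^ i) ((T ^^ n) x')) ((T ^^ i) ((T ^^ n) y'))"
        using e(2)[of "i + n"] by (simp add: funpow_add dist_commute)
    qed
    also have "\<dots> \<le> ?A x x' (N0 + n) + ?A y y' (N0 + n) + ?A ((T ^^ n) x') ((T ^^ n) y') N0"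
      unfolding sum.distrib by (intro add_mono shift) simp
    also have "\<dots> \<le> e / 4 * real (N0 + n) + e / 4 * real (N0 + n) + e / 4 * real N0"
      using N0[of N0] N0[of "N0 + n"] by (intro add_mono) auto
    finally have "e * real N0 \<le> e * (2 * real n)" by (simp add: field_simps)
    moreover have "2 * real n < real N0" using N0[of N0] by linarith
    ultimately show False using e(1) by simp
  qed
  then show "w \<in> proximal X T" using w by simp
qed

theorem mainTheorem7:
  fixes X :: "'a::metric_space set" and T :: "'a \<Rightarrow> 'a"
  assumes "dyn_sys X T" and "null_system X T"
  shows "(closedin (top_of_set (X \<times> X)) (proximal X T) \<longleftrightarrow> proximal X T = regionally_proximal X T)
       \<and> (proximal X T = regionally_proximal X T \<longleftrightarrow> mean_equicontinuous X T)"
proof -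
  have "closed (X \<times> X)" using dyn_sys_closed[OF assms(1)] by (simp add: closed_Times)
  then have "closedin (top_of_set (X \<times> X)) (proximal X T) \<longleftrightarrow> closed (proximal X T)"
    using proximal_subset by (metis closedin_closed_eq)
  \<comment> \<open>The implications run in a cycle: closed proximal relation, mean equicontinuity,
    equality of the relations, and closedness again.\<close>
  then show ?thesis
    using closed_proximal_imp_mean_equicontinuous[OF assms] mean_equicontinuous_imp_proximal_eq[OF assms(1)]
      regionally_proximal_closed[OF assms(1)] by metis
qed

end
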